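(* Let $\alpha\in(0,1)\cup(1,\infty)$ and let $\sigma$ be an arbitrary quantum state (randomness source) on a finite-dimensional system $B$ with eigenspace decomposition $\sigma=\sum_i\lambda_i\Pi_i$, and let $r_i=\mathrm{Tr}\,\Pi_i$. Then the maximal extractable Rényi entropy (of order $\alpha$) from $\sigma$ is the catalytic Rényi entropy of $\sigma$, $$S_\alpha^\diamond(\sigma)=\frac{1}{1-\alpha}\log_2\sum_i\lambda_i^\alpha r_i^{2-\alpha}.$$
   Context: All systems are finite-dimensional. $S_\alpha(\rho)=\frac{1}{1-\alpha}\log_2\mathrm{Tr}\,\rho^\alpha$. In the eigenspace decomposition, the $\lambda_i$ are the distinct eigenvalues of $\sigma$ and $\Pi_i$ are the orthogonal projectors onto the corresponding eigenspaces. A quantum map $\Phi$ on a system $A$ is a catalytic map using the catalyst $\sigma_B$ if there are a unitary $U$ on $AB$ and a unitary $V$ on $B$ with $\mathrm{Tr}_B\,U(\rho_A\otimes\sigma_B)U^\dagger=\Phi(\rho)$ and $\mathrm{Tr}_A\,U(\rho_A\otimes\sigma_B)U^\dagger=V\sigma_BV^\dagger$ for all states $\rho$ on $A$. The maximal extractable Rényi entropy of order $\alpha$ from $\sigma$ is the maximum of $S_\alpha((\mathcal{I}_R\otimes\Phi)(\rho))-S_\alpha(\rho)$ over all finite-dimensional systems $A$ and reference systems $R$, all catalytic maps $\Phi$ on $A$ using the catalyst $\sigma$, and all states $\rho$ on $RA$. *)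

theory Defs
  imports
    Complex_Main
    "Jordan_Normal_Form.Schur_Decomposition"
    "Jordan_Normal_Form.Spectral_Radius"
begin

text \<open>
  A system of dimension \<open>d\<close> is the Hilbert space of complex vectors of length \<open>d\<close>, and its
  operators are the complex \<open>d \<times> d\<close> matrices.  The basis vector \<open>|i\<rangle> \<otimes> |j\<rangle>\<close> of a bipartite
  system of dimensions \<open>d1\<close> and \<open>d2\<close> has index \<open>i * d2 + j\<close>.
\<close>

definition trace :: "complex mat \<Rightarrow> complex" where
  "trace A = (\<Sum>i<dim_row A. A $$ (i, i))"

definition hermitian :: "complex mat \<Rightarrow> bool" where
  "hermitian A \<longleftrightarrow> mat_adjoint A = A"

definition unitary :: "nat \<Rightarrow> complex mat \<Rightarrow> bool" where
  "unitary d U \<longleftrightarrow> U \<in> carrier_mat d d \<and> mat_adjoint U * U = 1\<^sub>m d \<and> U * mat_adjoint U = 1\<^sub>m d"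

text \<open>For a complex number \<open>z\<close>, \<open>0 \<le> z\<close> says that \<open>z\<close> is real and nonnegative.\<close>

definition psd :: "nat \<Rightarrow> complex mat \<Rightarrow> bool" where
  "psd d A \<longleftrightarrow> A \<in> carrier_mat d d \<and> hermitian A \<and> (\<forall>v \<in> carrier_vec d. 0 \<le> (A *\<^sub>v v) \<bullet>c v)"

definition state :: "nat \<Rightarrow> complex mat \<Rightarrow> bool" where
  "state d \<rho> \<longleftrightarrow> psd d \<rho> \<and> trace \<rho> = 1"

definition tensor :: "complex mat \<Rightarrow> complex mat \<Rightarrow> complex mat" where
  "tensor A B = mat (dim_row A * dim_row B) (dim_col A * dim_col B)
     (\<lambda>(i, j). A $$ (i div dim_row B, j div dim_col B) * B $$ (i mod dim_row B, j mod dim_col B))"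

text \<open>Traces over the first and over the second tensor factor.\<close>

definition ptrace1 :: "nat \<Rightarrow> nat \<Rightarrow> complex mat \<Rightarrow> complex mat" where
  "ptrace1 d1 d2 X = mat d2 d2 (\<lambda>(i, j). \<Sum>k<d1. X $$ (k * d2 + i, k * d2 + j))"

definition ptrace2 :: "nat \<Rightarrow> nat \<Rightarrow> complex mat \<Rightarrow> complex mat" where
  "ptrace2 d1 d2 X = mat d1 d1 (\<lambda>(i, j). \<Sum>k<d2. X $$ (i * d2 + k, j * d2 + k))"

text \<open>
  \<open>id_tensor d1 d2 \<Phi>\<close> is the map \<open>\<I> \<otimes> \<Phi>\<close>: it applies \<open>\<Phi>\<close> to each of the
  \<open>d1 \<times> d1\<close> blocks of size \<open>d2 \<times> d2\<close>.  For linear \<open>\<Phi>\<close> this is the linear map that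
  sends \<open>X \<otimes> Y\<close> to \<open>X \<otimes> \<Phi> Y\<close>.
\<close>

definition id_tensor ::
    "nat \<Rightarrow> nat \<Rightarrow> (complex mat \<Rightarrow> complex mat) \<Rightarrow> complex mat \<Rightarrow> complex mat" where
  "id_tensor d1 d2 \<Phi> X = mat (d1 * d2) (d1 * d2)
     (\<lambda>(i, j). \<Phi> (mat d2 d2 (\<lambda>(a, b). X $$ ((i div d2) * d2 + a, (j div d2) * d2 + b)))
                $$ (i mod d2, j mod d2))"

text \<open>Linear, trace-preserving and completely positive maps on the operators of one system.\<close>

definition quantum_map :: "nat \<Rightarrow> (complex mat \<Rightarrow> complex mat) \<Rightarrow> bool" where
  "quantum_map d \<Phi> \<longleftrightarrow>
     (\<forall>X \<in> carrier_mat d d. \<Phi> X \<in> carrier_mat d d) \<and>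
     (\<forall>X \<in> carrier_mat d d. \<forall>Y \<in> carrier_mat d d. \<Phi> (X + Y) = \<Phi> X + \<Phi> Y) \<and>
     (\<forall>c. \<forall>X \<in> carrier_mat d d. \<Phi> (c \<cdot>\<^sub>m X) = c \<cdot>\<^sub>m \<Phi> X) \<and>
     (\<forall>X \<in> carrier_mat d d. trace (\<Phi> X) = trace X) \<and>
     (\<forall>k X. psd (k * d) X \<longrightarrow> psd (k * d) (id_tensor k d \<Phi> X))"

definition catalytic_map ::
    "nat \<Rightarrow> nat \<Rightarrow> complex mat \<Rightarrow> (complex mat \<Rightarrow> complex mat) \<Rightarrow> bool" where
  "catalytic_map dA dB \<sigma> \<Phi> \<longleftrightarrow> quantum_map dA \<Phi> \<and>
     (\<exists>U V. unitary (dA * dB) U \<and> unitary dB V \<and>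
        (\<forall>\<rho>. state dA \<rho> \<longrightarrow>
           ptrace2 dA dB (U * tensor \<rho> \<sigma> * mat_adjoint U) = \<Phi> \<rho> \<and>
           ptrace1 dA dB (U * tensor \<rho> \<sigma> * mat_adjoint U) = V * \<sigma> * mat_adjoint V))"

definition eigenspace :: "complex mat \<Rightarrow> complex \<Rightarrow> complex vec set" where
  "eigenspace A l = {v \<in> carrier_vec (dim_row A). A *\<^sub>v v = l \<cdot>\<^sub>v v}"

definition orth_projector :: "nat \<Rightarrow> complex vec set \<Rightarrow> complex mat \<Rightarrow> bool" where
  "orth_projector d S P \<longleftrightarrow>
     P \<in> carrier_mat d d \<and> P * P = P \<and> hermitian P \<and> (\<lambda>v. P *\<^sub>v v) ` carrier_vec d = S"

definition eigenprojector :: "complex mat \<Rightarrow> complex \<Rightarrow> complex mat" where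
  "eigenprojector A l = (THE P. orth_projector (dim_row A) (eigenspace A l) P)"

text \<open>
  The power \<open>A\<^sup>\<alpha> = (\<Sum>l. l\<^sup>\<alpha> \<Pi>\<^sub>l)\<close> of a positive semidefinite matrix, summed over its
  distinct eigenvalues.  The sum is written entrywise because the type of matrices has no zero
  element; \<open>0 powr \<alpha> = 0\<close> is the right convention for \<open>\<alpha> > 0\<close>.
\<close>

definition mat_powr :: "complex mat \<Rightarrow> real \<Rightarrow> complex mat" where
  "mat_powr A \<alpha> = mat (dim_row A) (dim_row A)
     (\<lambda>(i, j). \<Sum>l \<in> spectrum A. complex_of_real (Re l powr \<alpha>) * eigenprojector A l $$ (i, j))"

definition renyi_entropy :: "real \<Rightarrow> complex mat \<Rightarrow> real" where
  "renyi_entropy \<alpha> \<rho> = 1 / (1 - \<alpha>) * log 2 (Re (trace (mat_powr \<rho> \<alpha>)))"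

text \<open>
  All entropy increases \<open>S\<^sub>\<alpha>((\<I>\<^sub>R \<otimes> \<Phi>)(\<rho>)) - S\<^sub>\<alpha>(\<rho>)\<close> achievable with the catalyst \<open>\<sigma>\<close>.
  Zero-dimensional systems contribute nothing, since they have no state.
\<close>

definition extractable_renyi_entropies :: "real \<Rightarrow> nat \<Rightarrow> complex mat \<Rightarrow> real set" where
  "extractable_renyi_entropies \<alpha> dB \<sigma> =
     {renyi_entropy \<alpha> (id_tensor dR dA \<Phi> \<rho>) - renyi_entropy \<alpha> \<rho> | dR dA \<Phi> \<rho>.
        catalytic_map dA dB \<sigma> \<Phi> \<and> state (dR * dA) \<rho>}"

definition is_maximal_extractable_renyi_entropy ::
    "real \<Rightarrow> nat \<Rightarrow> complex mat \<Rightarrow> real \<Rightarrow> bool" where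
  "is_maximal_extractable_renyi_entropy \<alpha> dB \<sigma> m \<longleftrightarrow>
     m \<in> extractable_renyi_entropies \<alpha> dB \<sigma> \<and>
     (\<forall>x \<in> extractable_renyi_entropies \<alpha> dB \<sigma>. x \<le> m)"

definition catalytic_renyi_entropy :: "real \<Rightarrow> complex mat \<Rightarrow> real" where
  "catalytic_renyi_entropy \<alpha> \<sigma> = 1 / (1 - \<alpha>) *
     log 2 (\<Sum>l \<in> spectrum \<sigma>. Re l powr \<alpha> * Re (trace (eigenprojector \<sigma> l)) powr (2 - \<alpha>))"

end

theory Submission
  imports Defs "HOL-Analysis.Convex" "HOL-Combinatorics.Transposition"
begin

text \<open>
  Conjugating by local unitaries, we may assume that \<open>\<sigma>\<close> is diagonal with entries \<open>s\<^sub>b\<close> and that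
  \<open>V = 1\<close>; write \<open>r\<^sub>b\<close> for the multiplicity of \<open>s\<^sub>b\<close>.  The catalytic entropy is then
  \<open>log\<^sub>2 (\<Sum>b. s\<^sub>b\<^sup>\<alpha> r\<^sub>b powr (1 - \<alpha>)) / (1 - \<alpha>)\<close>.

  Upper bound.  Feeding the maximally mixed state into the catalytic condition shows that
  \<open>U (1 \<otimes> \<sigma>) U\<^sup>*\<close> and \<open>1 \<otimes> \<sigma>\<close> have Hilbert-Schmidt distance 0, so the Kraus operators
  \<open>K\<^sub>p\<^sub>b = \<langle>p|U|b\<rangle>\<close> vanish unless \<open>s\<^sub>p = s\<^sub>b\<close>.  With the eigenvectors \<open>v\<^sub>m\<close> and eigenvalues \<open>e\<^sub>m\<close> of the
  input, the output is the sum of \<open>|w\<rangle>\<langle>w|\<close> over the vectors \<open>w\<^sub>p\<^sub>b\<^sub>m = (s\<^sub>b e\<^sub>m) powr (1/2) K\<^sub>p\<^sub>b v\<^sub>m\<close>.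
  The spectrum of a sum of \<open>|w\<rangle>\<langle>w|\<close> majorizes the squared norms, so the power sum of the output is
  bounded by that of the numbers \<open>\<bar>w\<^sub>p\<^sub>b\<^sub>m\<bar>\<^sup>2\<close>; these add up to \<open>s\<^sub>b e\<^sub>m\<close> over the \<open>r\<^sub>b\<close> relevant indices \<open>p\<close>,
  and Jensen's inequality finishes.  All inequalities carry a factor \<open>1 - \<alpha>\<close>, which treats
  \<open>\<alpha> < 1\<close> and \<open>\<alpha> > 1\<close> simultaneously.

  Attainment.  Two registers of \<open>A\<close> record the catalyst in two bases that are mutually unbiased within
  each eigenspace.  On a pure product input this outputs each \<open>s\<^sub>b / r\<^sub>b\<close> with multiplicity \<open>r\<^sub>b\<close>.
\<close>

section \<open>Unitary diagonalization of Hermitian matrices\<close>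

declare index_mult_mat(1) [simp del] and index_mult_mat_vec [simp del]

text \<open>With the general index rules removed from the simplifier, products unfold only on
  request, and then to explicit sums over \<open>{..<m}\<close> that can be swapped and
  factored.\<close>

lemma mult_entry:
  assumes "A \<in> carrier_mat n m" "B \<in> carrier_mat m k" "i < n" "j < k"
  shows "(A * B) $$ (i, j) = (\<Sum>l<m. A $$ (i, l) * B $$ (l, j))"
  using assms by (auto simp: index_mult_mat(1) scalar_prod_def lessThan_atLeast0 intro!: sum.cong)

lemma mult_vec_entry:
  assumes "A \<in> carrier_mat n m" "v \<in> carrier_vec m" "i < n"
  shows "(A *\<^sub>v v) $ i = (\<Sum>l<m. A $$ (i, l) * v $ l)"
  using assms by (auto simp: index_mult_mat_vec scalar_prod_def lessThan_atLeast0 intro!: sum.cong)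

lemma cscalar_prod_entry:
  fixes v w :: "complex vec"
  assumes "w \<in> carrier_vec n"
  shows "v \<bullet>c w = (\<Sum>i<n. v $ i * cnj (w $ i))"
  using assms by (auto simp: scalar_prod_def lessThan_atLeast0 intro!: sum.cong)

lemma dim_mat_adjoint [simp]:
  "dim_row (mat_adjoint A) = dim_col A" "dim_col (mat_adjoint A) = dim_row A"
  by (auto simp: mat_adjoint_def)

lemma mat_adjoint_carrier [simp]:
  "A \<in> carrier_mat n m \<Longrightarrow> mat_adjoint A \<in> carrier_mat m n"
  by (intro carrier_matI) auto

lemma mat_adjoint_entry:
  fixes A :: "complex mat"
  assumes "A \<in> carrier_mat n m" "i < m" "j < n"
  shows "mat_adjoint A $$ (i, j) = cnj (A $$ (j, i))"
  using assms by (auto simp: mat_adjoint_def mat_of_rows_def)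

lemma mat_adjoint_adjoint [simp]: "mat_adjoint (mat_adjoint A) = (A :: complex mat)"
  by (rule eq_matI) (auto simp: mat_adjoint_entry[of _ "dim_row A" "dim_col A"]
      mat_adjoint_entry[of _ "dim_col A" "dim_row A"])

lemma mat_adjoint_mult:
  fixes A B :: "complex mat"
  assumes "A \<in> carrier_mat n m" "B \<in> carrier_mat m k"
  shows "mat_adjoint (A * B) = mat_adjoint B * mat_adjoint A"
proof (rule eq_matI)
  fix i j assume "i < dim_row (mat_adjoint B * mat_adjoint A)"
    "j < dim_col (mat_adjoint B * mat_adjoint A)"
  then have ij: "i < k" "j < n" using assms by auto
  have "mat_adjoint (A * B) $$ (i, j) = cnj ((A * B) $$ (j, i))"
    by (rule mat_adjoint_entry[of _ n k]) (use assms ij in auto)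
  also have "\<dots> = (\<Sum>l<m. cnj (A $$ (j, l)) * cnj (B $$ (l, i)))"
    using mult_entry[OF assms ij(2) ij(1)] by simp
  also have "\<dots> = (\<Sum>l<m. mat_adjoint B $$ (i, l) * mat_adjoint A $$ (l, j))"
    using assms ij by (intro sum.cong refl) (auto simp: mat_adjoint_entry mult.commute)
  also have "\<dots> = (mat_adjoint B * mat_adjoint A) $$ (i, j)"
    by (rule mult_entry[symmetric]) (use assms ij in auto)
  finally show "mat_adjoint (A * B) $$ (i, j) = (mat_adjoint B * mat_adjoint A) $$ (i, j)" .
qed (use assms in auto)

lemma square_mult_carrier [simp]:
  "A \<in> carrier_mat n n \<Longrightarrow> B \<in> carrier_mat n n \<Longrightarrow> A * B \<in> carrier_mat n n"
  by (rule mult_carrier_mat)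

lemma unitary_carrier: "unitary n U \<Longrightarrow> U \<in> carrier_mat n n"
  by (simp add: unitary_def)

text \<open>A one-sided inverse of a square matrix is two-sided, so one product decides.\<close>

lemma unitaryI:
  assumes "U \<in> carrier_mat n n" "mat_adjoint U * U = 1\<^sub>m n"
  shows "unitary n U"
  using assms mat_mult_left_right_inverse[OF _ _ assms(2)] by (auto simp: unitary_def)

lemma unitaryI':
  assumes "U \<in> carrier_mat n n" "U * mat_adjoint U = 1\<^sub>m n"
  shows "unitary n U"
  using assms mat_mult_left_right_inverse[OF _ _ assms(2)] by (auto simp: unitary_def)

lemma unitary_adjoint: "unitary n U \<Longrightarrow> unitary n (mat_adjoint U)"
  by (auto simp: unitary_def)

lemma mat_adjoint_one [simp]: "mat_adjoint (1\<^sub>m n :: complex mat) = 1\<^sub>m n"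
  by (rule eq_matI) (auto simp: mat_adjoint_entry[of _ n n])

lemma unitary_one: "unitary n (1\<^sub>m n)"
  by (simp add: unitary_def)

lemma unitary_mult:
  assumes "unitary n U" "unitary n V"
  shows "unitary n (U * V)"
proof (rule unitaryI)
  have c: "U \<in> carrier_mat n n" "V \<in> carrier_mat n n"
    "mat_adjoint U \<in> carrier_mat n n" "mat_adjoint V \<in> carrier_mat n n"
    using assms by (auto simp: unitary_def)
  then show "U * V \<in> carrier_mat n n" by simp
  have "mat_adjoint (U * V) * (U * V) = mat_adjoint V * (mat_adjoint U * U) * V"
    using c by (simp add: mat_adjoint_mult[of U n n V n] assoc_mult_mat[of _ n n _ n _ n])
  then show "mat_adjoint (U * V) * (U * V) = 1\<^sub>m n"
    using assms c by (simp add: unitary_def)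
qed

lemma unitary_cols:
  assumes "unitary n U" "i < n" "j < n"
  shows "(\<Sum>k<n. cnj (U $$ (k, i)) * U $$ (k, j)) = (if i = j then 1 else 0)"
proof -
  have U: "U \<in> carrier_mat n n" using assms(1) by (rule unitary_carrier)
  have "(\<Sum>k<n. cnj (U $$ (k, i)) * U $$ (k, j)) = (mat_adjoint U * U) $$ (i, j)"
    using U assms by (subst mult_entry[of _ n n _ n]) (auto simp: mat_adjoint_entry)
  then show ?thesis using assms by (simp add: unitary_def)
qed

lemma unitary_rows:
  assumes "unitary n U" "i < n" "j < n"
  shows "(\<Sum>k<n. U $$ (i, k) * cnj (U $$ (j, k))) = (if i = j then 1 else 0)"
proof -
  have U: "U \<in> carrier_mat n n" using assms(1) by (rule unitary_carrier)
  have "(\<Sum>k<n. U $$ (i, k) * cnj (U $$ (j, k))) = (U * mat_adjoint U) $$ (i, j)"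
    using U assms by (subst mult_entry[of _ n n _ n]) (auto simp: mat_adjoint_entry)
  then show ?thesis using assms by (simp add: unitary_def)
qed

text \<open>Eigenvalues are carried as a real-valued function that lists them with multiplicity, so
  that \<open>powr\<close> and real inequalities apply to them directly.\<close>

definition real_diag :: "nat \<Rightarrow> (nat \<Rightarrow> real) \<Rightarrow> complex mat" where
  "real_diag n d = mat n n (\<lambda>(i, j). if i = j then complex_of_real (d i) else 0)"

lemma real_diag_carrier [simp]: "real_diag n d \<in> carrier_mat n n"
  by (simp add: real_diag_def)

lemma real_diag_entry [simp]:
  "i < n \<Longrightarrow> j < n \<Longrightarrow> real_diag n d $$ (i, j) = (if i = j then complex_of_real (d i) else 0)"
  by (simp add: real_diag_def)

lemma dim_real_diag [simp]: "dim_row (real_diag n d) = n" "dim_col (real_diag n d) = n"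
  by (simp_all add: real_diag_def)

lemma mult_delta_right: "x * (if P then y else 0) = (if P then x * y else (0 :: 'a :: mult_zero))"
  by simp

lemma mult_delta_left: "(if P then y else 0) * x = (if P then y * x else (0 :: 'a :: mult_zero))"
  by simp

lemma mult_real_diag:
  assumes "A \<in> carrier_mat n n" "i < n" "j < n"
  shows "(A * real_diag n d) $$ (i, j) = A $$ (i, j) * complex_of_real (d j)"
  using assms by (subst mult_entry[of _ n n _ n]) (auto simp: mult_delta_right)

lemma conj_real_diag_entry:
  assumes "Q \<in> carrier_mat n n" "i < n" "j < n"
  shows "(Q * real_diag n d * mat_adjoint Q) $$ (i, j)
    = (\<Sum>k<n. complex_of_real (d k) * Q $$ (i, k) * cnj (Q $$ (j, k)))"
  using assms
  by (subst mult_entry[of _ n n _ n])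
    (auto simp: mult_real_diag mat_adjoint_entry mult_ac intro!: sum.cong)

lemma mat_adjoint_real_diag [simp]: "mat_adjoint (real_diag n d) = real_diag n d"
  by (rule eq_matI) (auto simp: mat_adjoint_entry[of _ n n])

lemma hermitian_conj:
  assumes "hermitian A" "A \<in> carrier_mat n n" "W \<in> carrier_mat n n"
  shows "hermitian (mat_adjoint W * A * W)"
  using assms by (simp add: hermitian_def mat_adjoint_mult[of _ n n _ n]
      assoc_mult_mat[of _ n n _ n _ n])

lemma hermitian_conj_real_diag:
  assumes "Q \<in> carrier_mat n n"
  shows "hermitian (Q * real_diag n d * mat_adjoint Q)"
  using hermitian_conj[of "real_diag n d" n "mat_adjoint Q"] assms
  by (simp add: hermitian_def)

lemma conj_unitary_cancel:
  assumes "unitary n W" "A \<in> carrier_mat n n"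
  shows "W * (mat_adjoint W * A * W) * mat_adjoint W = A"
proof -
  have c: "W \<in> carrier_mat n n" "mat_adjoint W \<in> carrier_mat n n"
    using assms by (auto simp: unitary_def)
  have "W * (mat_adjoint W * A * W) * mat_adjoint W
      = (W * mat_adjoint W) * A * (W * mat_adjoint W)"
    using c assms(2) by (simp add: assoc_mult_mat[of _ n n _ n _ n])
  then show ?thesis using assms by (simp add: unitary_def)
qed

lemma cscalar_prod_self:
  fixes v :: "complex vec"
  assumes "v \<in> carrier_vec n"
  shows "v \<bullet>c v = complex_of_real (\<Sum>i<n. (cmod (v $ i))\<^sup>2)"
  unfolding cscalar_prod_entry[OF assms]
  by (simp flip: complex_norm_square)

text \<open>Complete \<open>v\<close> to a basis, orthogonalize by Gram-Schmidt, which keeps the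
  first vector, and normalize the columns. The witness for \<open>c\<close> is the reciprocal of the
  norm of \<open>v\<close>.\<close>

lemma unitary_with_first_col:
  fixes v :: "complex vec"
  assumes v: "v \<in> carrier_vec n" and v0: "v \<noteq> 0\<^sub>v n"
  shows "\<exists>W c. unitary n W \<and> (\<forall>i<n. W $$ (i, 0) = c * v $ i)"
proof -
  interpret cof_vec_space n "TYPE(complex)" .
  define b where "b = basis_completion v"
  from basis_completion[OF v v0, folded b_def]
  have dist_b: "distinct b" and indep: "\<not> lin_dep (set b)" and b: "set b \<subseteq> carrier_vec n"
    and hdb: "hd b = v" and len_b: "length b = n" by auto
  have n: "n \<noteq> 0" using v v0 by (metis eq_vecI carrier_vecD index_zero_vec(2) less_nat_zero_code)
  then obtain vs where bv: "b = v # vs" using hdb len_b by (cases b) auto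
  define ws where "ws = gram_schmidt n b"
  from gram_schmidt_result[OF b dist_b indep refl, folded ws_def]
  have ws: "set ws \<subseteq> carrier_vec n" "corthogonal ws" "length ws = n" by (auto simp: len_b)
  have hdws: "hd ws = v" unfolding ws_def bv using v by simp
  have wi: "ws ! i \<in> carrier_vec n" if "i < n" for i using ws that by auto
  define N where "N i = (\<Sum>k<n. (cmod (ws ! i $ k))\<^sup>2)" for i
  have sq: "ws ! i \<bullet>c ws ! i = complex_of_real (N i)" if "i < n" for i
    unfolding N_def by (rule cscalar_prod_self[OF wi[OF that]])
  have Npos: "N i > 0" if i: "i < n" for i
  proof -
    have "complex_of_real (N i) \<noteq> 0"
      using corthogonalD[OF ws(2), of i i] i ws(3) sq[OF i] by auto
    moreover have "N i \<ge> 0" unfolding N_def by (intro sum_nonneg) auto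
    ultimately show ?thesis by auto
  qed
  define W where "W = mat n n (\<lambda>(i, j). ws ! j $ i / complex_of_real (sqrt (N j)))"
  have W: "W \<in> carrier_mat n n" by (simp add: W_def)
  have "mat_adjoint W * W = 1\<^sub>m n"
  proof (rule eq_matI)
    fix i j assume "i < dim_row (1\<^sub>m n :: complex mat)" "j < dim_col (1\<^sub>m n :: complex mat)"
    then have ij: "i < n" "j < n" by auto
    have "(mat_adjoint W * W) $$ (i, j) = (\<Sum>k<n. cnj (W $$ (k, i)) * W $$ (k, j))"
      using W ij by (subst mult_entry[of _ n n _ n]) (auto simp: mat_adjoint_entry)
    also have "\<dots> = (\<Sum>k<n. ws ! j $ k * cnj (ws ! i $ k)) /
        (complex_of_real (sqrt (N j)) * complex_of_real (sqrt (N i)))"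
      using ij by (simp add: W_def sum_divide_distrib mult_ac)
    also have "(\<Sum>k<n. ws ! j $ k * cnj (ws ! i $ k)) = ws ! j \<bullet>c ws ! i"
      by (rule cscalar_prod_entry[OF wi[OF ij(1)], symmetric])
    also have "ws ! j \<bullet>c ws ! i / (complex_of_real (sqrt (N j)) * complex_of_real (sqrt (N i)))
      = (if i = j then 1 else 0)"
    proof (cases "i = j")
      case True
      have "complex_of_real (sqrt (N j)) * complex_of_real (sqrt (N i)) = complex_of_real (N i)"
        using True Npos[OF ij(1)] by (simp flip: of_real_mult)
      then show ?thesis using True sq[OF ij(1)] Npos[OF ij(1)] by simp
    next
      case False
      then show ?thesis using corthogonalD[OF ws(2), of j i] ij ws(3) by simp
    qed
    finally show "(mat_adjoint W * W) $$ (i, j) = 1\<^sub>m n $$ (i, j)" using ij by simp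
  qed (use W in auto)
  then have "unitary n W" by (intro unitaryI W)
  moreover have "\<forall>i<n. W $$ (i, 0) = (1 / complex_of_real (sqrt (N 0))) * v $ i"
    using n hdws ws(3) by (auto simp: W_def hd_conv_nth)
  ultimately show ?thesis by blast
qed

text \<open>Induction on the dimension. With an eigenvector in the first column of a unitary
  \<open>W\<close>, the conjugated matrix \<open>B\<close> has a multiple of the first basis vector
  as its first column; as \<open>B\<close> is Hermitian, the same holds for its first row, and the
  induction hypothesis diagonalizes the remaining block.\<close>

theorem hermitian_diagonalization:
  assumes "A \<in> carrier_mat n n" "hermitian A"
  shows "\<exists>Q d. unitary n Q \<and> A = Q * real_diag n d * mat_adjoint Q"
  using assms
proof (induction n arbitrary: A)
  case 0
  then show ?case by (intro exI[of _ "1\<^sub>m 0"] exI[of _ "\<lambda>_. 0"]) (auto intro: unitary_one)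
next
  case (Suc n)
  note A = Suc.prems(1)
  obtain e where "eigenvalue A e" using spectrum_non_empty[OF A] by (auto simp: spectrum_def)
  then obtain v where v: "v \<in> carrier_vec (Suc n)" "v \<noteq> 0\<^sub>v (Suc n)" "A *\<^sub>v v = e \<cdot>\<^sub>v v"
    using A by (auto simp: eigenvalue_def eigenvector_def)
  obtain W c where W: "unitary (Suc n) W" and W0: "\<And>i. i < Suc n \<Longrightarrow> W $$ (i, 0) = c * v $ i"
    using unitary_with_first_col[OF v(1,2)] by blast
  have Wc: "W \<in> carrier_mat (Suc n) (Suc n)" using W by (rule unitary_carrier)
  define B where "B = mat_adjoint W * A * W"
  have Bc: "B \<in> carrier_mat (Suc n) (Suc n)" using Wc A by (auto simp: B_def)
  have Bh: "hermitian B" unfolding B_def by (rule hermitian_conj[OF Suc.prems(2) A Wc])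
  have Bsym: "B $$ (i, j) = cnj (B $$ (j, i))" if "i < Suc n" "j < Suc n" for i j
    using mat_adjoint_entry[OF Bc that] Bh by (simp add: hermitian_def)
  have AW0: "(A * W) $$ (i, 0) = e * W $$ (i, 0)" if i: "i < Suc n" for i
  proof -
    have "(A * W) $$ (i, 0) = c * (A *\<^sub>v v) $ i"
      unfolding mult_entry[OF A Wc i zero_less_Suc] mult_vec_entry[OF A v(1) i]
      by (simp add: W0 sum_distrib_left mult_ac del: sum.lessThan_Suc)
    then show ?thesis using v i by (simp add: W0)
  qed
  have B0: "B $$ (i, 0) = (if i = 0 then e else 0)" if i: "i < Suc n" for i
  proof -
    have "B = mat_adjoint W * (A * W)"
      using Wc A by (simp add: B_def assoc_mult_mat[of _ "Suc n" "Suc n" _ "Suc n" _ "Suc n"])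
    then have "B $$ (i, 0) = (\<Sum>k<Suc n. mat_adjoint W $$ (i, k) * (A * W) $$ (k, 0))"
      using mult_entry[of "mat_adjoint W" "Suc n" "Suc n" "A * W" "Suc n" i 0] Wc A i
      by (simp del: sum.lessThan_Suc)
    also have "\<dots> = e * (\<Sum>k<Suc n. cnj (W $$ (k, i)) * W $$ (k, 0))"
      unfolding sum_distrib_left
    proof (intro sum.cong refl)
      fix k assume "k \<in> {..<Suc n}"
      then show "mat_adjoint W $$ (i, k) * (A * W) $$ (k, 0)
          = e * (cnj (W $$ (k, i)) * W $$ (k, 0))"
        using mat_adjoint_entry[OF Wc i, of k] AW0[of k] by simp
    qed
    also have "\<dots> = (if i = 0 then e else 0)"
      using unitary_cols[OF W i zero_less_Suc] by (simp del: sum.lessThan_Suc)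
    finally show ?thesis .
  qed
  have e_real: "e = complex_of_real (Re e)"
  proof -
    have "B $$ (0, 0) = e" using B0[OF zero_less_Suc] by simp
    then have "cnj e = e" using Bsym[OF zero_less_Suc zero_less_Suc] by simp
    then show ?thesis by (metis Reals_cnj_iff of_real_Re)
  qed
  have B0': "B $$ (0, j) = (if j = 0 then e else 0)" if j: "j < Suc n" for j
  proof (cases "j = 0")
    case False
    then have "B $$ (0, j) = cnj 0"
      unfolding Bsym[OF zero_less_Suc j] B0[OF j] by simp
    then show ?thesis using False by simp
  qed (use B0[of 0] in simp)
  define B' where "B' = mat n n (\<lambda>(i, j). B $$ (Suc i, Suc j))"
  have B'c: "B' \<in> carrier_mat n n" by (simp add: B'_def)
  have "hermitian B'"
    unfolding hermitian_def
  proof (rule eq_matI)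
    fix i j assume "i < dim_row B'" "j < dim_col B'"
    then have ij: "i < n" "j < n" using B'c by auto
    show "mat_adjoint B' $$ (i, j) = B' $$ (i, j)"
      unfolding mat_adjoint_entry[OF B'c ij] using ij Bsym[of "Suc i" "Suc j"]
      by (simp add: B'_def)
  qed (use B'c in auto)
  from Suc.IH[OF B'c this] obtain Q' d' where Q': "unitary n Q'"
    and B'eq: "B' = Q' * real_diag n d' * mat_adjoint Q'" by blast
  have Q'c: "Q' \<in> carrier_mat n n" using Q' by (rule unitary_carrier)
  \<comment> \<open>The block sum of 1 and \<open>Q'\<close>; the index shift by one skips the
    eigenvector that has been split off.\<close>
  define Q where "Q = mat (Suc n) (Suc n) (\<lambda>(i, j). if i = 0 \<or> j = 0 then (if i = j then 1 else 0)
    else Q' $$ (i - 1, j - 1))"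
  define d where "d i = (if i = 0 then Re e else d' (i - 1))" for i
  have Qc: "Q \<in> carrier_mat (Suc n) (Suc n)" by (simp add: Q_def)
  have Q: "unitary (Suc n) Q"
  proof (rule unitaryI[OF Qc], rule eq_matI)
    fix i j assume "i < dim_row (1\<^sub>m (Suc n) :: complex mat)" "j < dim_col (1\<^sub>m (Suc n) :: complex mat)"
    then have ij: "i < Suc n" "j < Suc n" by auto
    have "(mat_adjoint Q * Q) $$ (i, j) = (\<Sum>k<Suc n. cnj (Q $$ (k, i)) * Q $$ (k, j))"
      using Qc ij by (subst mult_entry[of _ "Suc n" "Suc n" _ "Suc n"])
        (auto simp: mat_adjoint_entry simp del: sum.lessThan_Suc intro!: sum.cong)
    also have "\<dots> = (if i = j then 1 else 0)"
      using ij unitary_cols[OF Q', of "i - 1" "j - 1"]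
      unfolding sum.lessThan_Suc_shift by (cases i; cases j) (auto simp: Q_def)
    finally show "(mat_adjoint Q * Q) $$ (i, j) = 1\<^sub>m (Suc n) $$ (i, j)" using ij by simp
  qed (use Qc in auto)
  have "B = Q * real_diag (Suc n) d * mat_adjoint Q"
  proof (rule eq_matI)
    fix i j assume "i < dim_row (Q * real_diag (Suc n) d * mat_adjoint Q)"
      "j < dim_col (Q * real_diag (Suc n) d * mat_adjoint Q)"
    then have ij: "i < Suc n" "j < Suc n" using Qc by auto
    have *: "B $$ (Suc i', Suc j') = (\<Sum>k<n. complex_of_real (d' k) * Q' $$ (i', k) * cnj (Q' $$ (j', k)))"
      if "i' < n" "j' < n" for i' j'
      using conj_real_diag_entry[OF Q'c that, of d', folded B'eq] that by (simp add: B'_def)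
    have "(Q * real_diag (Suc n) d * mat_adjoint Q) $$ (i, j)
      = (\<Sum>k<Suc n. complex_of_real (d k) * Q $$ (i, k) * cnj (Q $$ (j, k)))"
      by (rule conj_real_diag_entry[OF Qc ij])
    also have "\<dots> = B $$ (i, j)"
      using ij B0 B0' e_real[symmetric] unfolding sum.lessThan_Suc_shift
      by (cases i; cases j) (auto simp: Q_def d_def *)
    finally show "B $$ (i, j) = (Q * real_diag (Suc n) d * mat_adjoint Q) $$ (i, j)" by simp
  qed (use Bc Qc in auto)
  then have "A = W * (Q * real_diag (Suc n) d * mat_adjoint Q) * mat_adjoint W"
    using conj_unitary_cancel[OF W A, folded B_def] by simp
  also have "\<dots> = (W * Q) * real_diag (Suc n) d * mat_adjoint (W * Q)"
    using Wc Qc by (simp add: mat_adjoint_mult[OF Wc Qc]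
        assoc_mult_mat[of _ "Suc n" "Suc n" _ "Suc n" _ "Suc n"])
  finally show ?case using unitary_mult[OF W Q] by blast
qed

section \<open>Entropies in terms of eigenvalues\<close>

lemma conj_real_diag_mult:
  assumes "unitary n Q"
  shows "(Q * real_diag n d * mat_adjoint Q) * (Q * real_diag n e * mat_adjoint Q)
    = Q * real_diag n (\<lambda>i. d i * e i) * mat_adjoint Q"
proof -
  have c: "Q \<in> carrier_mat n n" "mat_adjoint Q \<in> carrier_mat n n"
    using assms by (auto simp: unitary_def)
  have d: "real_diag n d * real_diag n e = real_diag n (\<lambda>i. d i * e i)"
    by (rule eq_matI) (auto simp: mult_real_diag)
  have "(Q * real_diag n d * mat_adjoint Q) * (Q * real_diag n e * mat_adjoint Q)
    = Q * (real_diag n d * ((mat_adjoint Q * Q) * (real_diag n e * mat_adjoint Q)))"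
    using c by (simp add: assoc_mult_mat[of _ n n _ n _ n])
  also have "\<dots> = Q * (real_diag n d * real_diag n e) * mat_adjoint Q"
    using c assms by (simp add: unitary_def assoc_mult_mat[of _ n n _ n _ n])
  finally show ?thesis by (simp add: d)
qed

lemma trace_conj_real_diag:
  assumes "unitary n Q"
  shows "trace (Q * real_diag n d * mat_adjoint Q) = complex_of_real (\<Sum>i<n. d i)"
proof -
  have Q: "Q \<in> carrier_mat n n" using assms by (rule unitary_carrier)
  have "trace (Q * real_diag n d * mat_adjoint Q)
    = (\<Sum>i<n. \<Sum>k<n. complex_of_real (d k) * Q $$ (i, k) * cnj (Q $$ (i, k)))"
    using Q by (simp add: trace_def conj_real_diag_entry)
  also have "\<dots> = (\<Sum>k<n. complex_of_real (d k) * (\<Sum>i<n. cnj (Q $$ (i, k)) * Q $$ (i, k)))"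
    by (subst sum.swap) (simp add: sum_distrib_left mult_ac)
  also have "\<dots> = (\<Sum>k<n. complex_of_real (d k))"
    by (intro sum.cong refl) (simp add: unitary_cols[OF assms])
  finally show ?thesis by simp
qed

text \<open>Conjugation by a unitary is a similarity, so the characteristic polynomial is that of
  the diagonal matrix.\<close>

lemma spectrum_conj_real_diag:
  assumes "unitary n Q"
  shows "spectrum (Q * real_diag n d * mat_adjoint Q) = (\<lambda>i. complex_of_real (d i)) ` {..<n}"
proof -
  let ?A = "Q * real_diag n d * mat_adjoint Q"
  have Q: "Q \<in> carrier_mat n n" using assms by (rule unitary_carrier)
  have A: "?A \<in> carrier_mat n n" using Q by simp
  have "similar_mat_wit ?A (real_diag n d) Q (mat_adjoint Q)"
    by (rule similar_mat_witI[of _ _ n]) (use Q assms in \<open>auto simp: unitary_def\<close>)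
  then have "char_poly ?A = char_poly (real_diag n d)"
    by (intro char_poly_similar) (auto simp: similar_mat_def)
  also have "\<dots> = (\<Prod>a \<leftarrow> diag_mat (real_diag n d). [:- a, 1:])"
    by (rule char_poly_upper_triangular[of _ n]) (auto simp: upper_triangular_def)
  finally have cp: "char_poly ?A = (\<Prod>a \<leftarrow> diag_mat (real_diag n d). [:- a, 1:])" .
  have "set (diag_mat (real_diag n d)) = (\<lambda>i. complex_of_real (d i)) ` {..<n}"
    by (auto simp: diag_mat_def)
  then show ?thesis
    unfolding spectrum_def set_eq_iff mem_Collect_eq eigenvalue_root_char_poly[OF A] cp
    by (auto simp: poly_prod_list prod_list_zero_iff)
qed

lemma mult_unit_vec:
  fixes A :: "complex mat"
  assumes "A \<in> carrier_mat n m" "j < m"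
  shows "A *\<^sub>v unit_vec m j = col A j"
  by (rule eq_vecI) (use assms in \<open>auto simp: mult_vec_entry[of _ n m] mult_delta_right\<close>)

text \<open>Justifies the \<open>THE\<close> in \<open>eigenprojector\<close>. Each projector is the
  identity on the common range, so \<open>P' * P = P\<close> and \<open>P * P' = P'\<close>; taking
  adjoints in the first equation gives \<open>P = P * P'\<close>.\<close>

lemma orth_projector_unique:
  assumes "orth_projector n S P" "orth_projector n S P'"
  shows "P = P'"
proof -
  have absorb: "P * P' = P'" if "orth_projector n S P" "orth_projector n S P'" for P P'
  proof (rule eq_matI)
    have P: "P \<in> carrier_mat n n" "P * P = P" "(\<lambda>v. P *\<^sub>v v) ` carrier_vec n = S"
      and P': "P' \<in> carrier_mat n n" "(\<lambda>v. P' *\<^sub>v v) ` carrier_vec n = S"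
      using that by (auto simp: orth_projector_def)
    fix i j assume "i < dim_row P'" "j < dim_col P'"
    then have ij: "i < n" "j < n" using P' by auto
    have "P' *\<^sub>v unit_vec n j \<in> S" using P' by auto
    then obtain w where w: "w \<in> carrier_vec n" "P' *\<^sub>v unit_vec n j = P *\<^sub>v w"
      using P by auto
    have "col (P * P') j = P *\<^sub>v (P' *\<^sub>v unit_vec n j)"
      unfolding mult_unit_vec[OF P'(1) ij(2)] by (rule col_mult2[OF P(1) P'(1) ij(2)])
    also have "\<dots> = P' *\<^sub>v unit_vec n j"
      unfolding w(2) assoc_mult_mat_vec[OF P(1) P(1) w(1), symmetric] P(2) ..
    also have "\<dots> = col P' j" using P' ij by (simp add: mult_unit_vec)
    finally have "col (P * P') j $ i = col P' j $ i" by simp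
    then show "(P * P') $$ (i, j) = P' $$ (i, j)"
      using P P' ij by (simp add: index_mult_mat(1) index_mult_mat_vec)
  qed (use that in \<open>auto simp: orth_projector_def\<close>)
  have h: "mat_adjoint P = P" "mat_adjoint P' = P'" and c: "P \<in> carrier_mat n n" "P' \<in> carrier_mat n n"
    using assms by (auto simp: orth_projector_def hermitian_def)
  have "P = mat_adjoint (P' * P)" using absorb[OF assms(2,1)] h by simp
  also have "\<dots> = P * P'" using c h by (simp add: mat_adjoint_mult[of _ n n _ n])
  finally show ?thesis using absorb[OF assms] by simp
qed

text \<open>The candidate \<open>P\<close> is the indicator of the indices that carry
  \<open>l\<close>, written in the eigenbasis. The equation for \<open>A * P\<close> puts its range
  inside the eigenspace; conversely, the coordinates of an eigenvector vanish wherever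
  \<open>d i\<close> differs from \<open>l\<close>, so \<open>P\<close> fixes it.\<close>

lemma eigenprojector_conj_real_diag:
  assumes Q: "unitary n Q"
  shows "eigenprojector (Q * real_diag n d * mat_adjoint Q) l
    = Q * real_diag n (\<lambda>i. of_bool (complex_of_real (d i) = l)) * mat_adjoint Q"
proof -
  define A where "A = Q * real_diag n d * mat_adjoint Q"
  define p where "p i = (of_bool (complex_of_real (d i) = l) :: real)" for i
  define P where "P = Q * real_diag n p * mat_adjoint Q"
  have Qc: "Q \<in> carrier_mat n n" "mat_adjoint Q \<in> carrier_mat n n"
    using Q by (auto simp: unitary_def)
  have A: "A \<in> carrier_mat n n" and P: "P \<in> carrier_mat n n"
    using Qc by (auto simp: A_def P_def)
  have PP: "P * P = P"
    unfolding P_def conj_real_diag_mult[OF Q]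
    by (intro arg_cong[of _ _ "\<lambda>x. Q * x * _"] arg_cong[of _ _ "real_diag n"]) (auto simp: p_def)
  have AP: "A * P = l \<cdot>\<^sub>m P"
  proof (rule eq_matI)
    fix i j assume "i < dim_row (l \<cdot>\<^sub>m P)" "j < dim_col (l \<cdot>\<^sub>m P)"
    then have ij: "i < n" "j < n" using P by auto
    show "(A * P) $$ (i, j) = (l \<cdot>\<^sub>m P) $$ (i, j)"
      using ij P Qc unfolding A_def P_def conj_real_diag_mult[OF Q]
      by (auto simp: conj_real_diag_entry sum_distrib_left p_def intro!: sum.cong)
  qed (use A P in auto)
  have "(\<lambda>v. P *\<^sub>v v) ` carrier_vec n = eigenspace A l"
  proof (intro equalityI subsetI)
    fix w assume "w \<in> (\<lambda>v. P *\<^sub>v v) ` carrier_vec n"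
    then obtain v where v: "v \<in> carrier_vec n" "w = P *\<^sub>v v" by auto
    have "A *\<^sub>v w = (A * P) *\<^sub>v v" using A P v by simp
    also have "\<dots> = l \<cdot>\<^sub>v w" unfolding AP v(2) using P v(1) 
      by (intro eq_vecI) (auto simp: mult_vec_entry[of _ n n] sum_distrib_left mult_ac)
    finally show "w \<in> eigenspace A l" using v A P by (auto simp: eigenspace_def)
  next
    fix v assume "v \<in> eigenspace A l"
    then have v: "v \<in> carrier_vec n" "A *\<^sub>v v = l \<cdot>\<^sub>v v" using A by (auto simp: eigenspace_def)
    define w where "w = mat_adjoint Q *\<^sub>v v"
    have w: "w \<in> carrier_vec n" using mult_mat_vec_carrier[OF Qc(2) v(1)] by (simp add: w_def)
    have Qw: "Q *\<^sub>v w = v"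
      unfolding w_def assoc_mult_mat_vec[OF Qc v(1), symmetric] using Q v by (simp add: unitary_def)
    have "l \<cdot>\<^sub>v w = mat_adjoint Q *\<^sub>v (A *\<^sub>v v)"
      unfolding v(2) w_def using Qc v(1) by (simp add: mult_mat_vec[of _ n n])
    also have "\<dots> = (mat_adjoint Q * A) *\<^sub>v v"
      by (rule assoc_mult_mat_vec[OF Qc(2) A v(1), symmetric])
    also have "mat_adjoint Q * A = (mat_adjoint Q * Q) * (real_diag n d * mat_adjoint Q)"
      unfolding A_def using Qc by (simp add: assoc_mult_mat[of _ n n _ n _ n])
    also have "\<dots> = real_diag n d * mat_adjoint Q" using Q Qc by (simp add: unitary_def)
    also have "\<dots> *\<^sub>v v = real_diag n d *\<^sub>v w"
      unfolding w_def using Qc v by (intro assoc_mult_mat_vec) auto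
    finally have lw: "l \<cdot>\<^sub>v w = real_diag n d *\<^sub>v w" .
    have "real_diag n p *\<^sub>v w = w"
    proof (rule eq_vecI)
      fix i assume "i < dim_vec w"
      then have i: "i < n" using w by auto
      have "(\<Sum>k<n. real_diag n e $$ (i, k) * w $ k) = complex_of_real (e i) * w $ i" for e
        using i by (auto simp: mult_delta_left)
      note D = this[folded mult_vec_entry[OF real_diag_carrier w i]]
      have "l * w $ i = complex_of_real (d i) * w $ i"
        using arg_cong[OF lw, of "\<lambda>u. u $ i"] i w by (simp add: D)
      then show "(real_diag n p *\<^sub>v w) $ i = w $ i" by (auto simp: D p_def)
    qed (use w in auto)
    then have "v = Q *\<^sub>v (real_diag n p *\<^sub>v (mat_adjoint Q *\<^sub>v v))"
      using Qw by (simp add: w_def)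
    also have "\<dots> = P *\<^sub>v v" unfolding P_def using Qc v(1)
      by (simp add: assoc_mult_mat_vec[of _ n n _ n] mult_mat_vec_carrier[OF Qc(2)])
    finally show "v \<in> (\<lambda>v. P *\<^sub>v v) ` carrier_vec n" using v(1) by blast
  qed
  then have "orth_projector n (eigenspace A l) P"
    using P PP hermitian_conj_real_diag[OF Qc(1), of p] by (auto simp: orth_projector_def P_def)
  moreover have "dim_row A = n" using A by simp
  ultimately have "eigenprojector A l = P"
    unfolding eigenprojector_def by (auto intro: orth_projector_unique)
  then show ?thesis by (simp add: A_def P_def flip: p_def)
qed

text \<open>Translates between sums over distinct eigenvalues weighted by multiplicity, as in the
  definitions of the entropies, and sums over diagonal positions.\<close>

lemma sum_group_values:
  fixes g :: "'b \<Rightarrow> 'c :: comm_semiring_1"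
  assumes "finite S"
  shows "(\<Sum>y\<in>f ` S. g y * of_nat (card {x \<in> S. f x = y})) = (\<Sum>x\<in>S. g (f x))"
proof -
  have "(\<Sum>x\<in>S. g (f x)) = (\<Sum>y\<in>f ` S. \<Sum>x\<in>{x \<in> S. f x = y}. g (f x))"
    using assms by (rule sum.image_gen)
  also have "\<dots> = (\<Sum>y\<in>f ` S. g y * of_nat (card {x \<in> S. f x = y}))"
    by (intro sum.cong refl) (simp add: mult.commute)
  finally show ?thesis ..
qed

lemma trace_eigenprojector:
  assumes "unitary n Q"
  shows "trace (eigenprojector (Q * real_diag n d * mat_adjoint Q) l)
    = of_nat (card {i \<in> {..<n}. complex_of_real (d i) = l})"
  unfolding eigenprojector_conj_real_diag[OF assms] trace_conj_real_diag[OF assms]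
  by (simp add: Int_def of_bool_def flip: sum.inter_filter)

lemma renyi_entropy_conj_real_diag:
  assumes Q: "unitary n Q"
  shows "renyi_entropy \<alpha> (Q * real_diag n d * mat_adjoint Q)
    = 1 / (1 - \<alpha>) * log 2 (\<Sum>i<n. d i powr \<alpha>)"
proof -
  let ?A = "Q * real_diag n d * mat_adjoint Q" and ?f = "\<lambda>i. complex_of_real (d i)"
  have dim: "dim_row ?A = n" and Pc: "dim_row (eigenprojector ?A l) = n" for l
    using unitary_carrier[OF Q] by (auto simp: eigenprojector_conj_real_diag[OF Q])
  have "trace (mat_powr ?A \<alpha>)
      = (\<Sum>i<n. \<Sum>l\<in>spectrum ?A. complex_of_real (Re l powr \<alpha>) * eigenprojector ?A l $$ (i, i))"
    by (simp only: trace_def mat_powr_def dim) simp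
  also have "\<dots> = (\<Sum>l\<in>spectrum ?A. complex_of_real (Re l powr \<alpha>) * trace (eigenprojector ?A l))"
    by (subst sum.swap) (simp add: trace_def Pc sum_distrib_left)
  also have "\<dots> = (\<Sum>l\<in>?f ` {..<n}. complex_of_real (Re l powr \<alpha>) * of_nat (card {i \<in> {..<n}. ?f i = l}))"
    unfolding spectrum_conj_real_diag[OF Q] trace_eigenprojector[OF Q] ..
  also have "\<dots> = complex_of_real (\<Sum>i<n. d i powr \<alpha>)"
    by (subst sum_group_values) auto
  finally show ?thesis by (simp add: renyi_entropy_def)
qed

text \<open>The multiplicity of the eigenvalue \<open>s b\<close>, attached to the position
  \<open>b\<close> instead of the value, so that later sums run over \<open>{..<n}\<close>.\<close>

definition block_size :: "nat \<Rightarrow> (nat \<Rightarrow> real) \<Rightarrow> nat \<Rightarrow> nat" where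
  "block_size n s b = card {c \<in> {..<n}. s c = s b}"

lemma block_size_pos: "b < n \<Longrightarrow> block_size n s b > 0"
  unfolding block_size_def by (subst card_gt_0_iff) auto

text \<open>One factor of the multiplicity is spent on turning the sum over distinct eigenvalues
  into a sum over positions; this lowers the exponent from \<open>2 - \<alpha>\<close> to
  \<open>1 - \<alpha>\<close>.\<close>

lemma catalytic_renyi_entropy_conj_real_diag:
  assumes Q: "unitary n Q"
  shows "catalytic_renyi_entropy \<alpha> (Q * real_diag n s * mat_adjoint Q)
    = 1 / (1 - \<alpha>) * log 2 (\<Sum>b<n. s b powr \<alpha> * block_size n s b powr (1 - \<alpha>))"
proof -
  let ?f = "\<lambda>i. complex_of_real (s i)" and ?r = "\<lambda>l. card {i \<in> {..<n}. complex_of_real (s i) = l}"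
  have "(\<Sum>l\<in>?f ` {..<n}. Re l powr \<alpha> * real (?r l) powr (2 - \<alpha>))
    = (\<Sum>l\<in>?f ` {..<n}. (Re l powr \<alpha> * real (?r l) powr (1 - \<alpha>)) * of_nat (?r l))"
  proof (intro sum.cong refl)
    fix l assume "l \<in> ?f ` {..<n}"
    then have "?r l > 0" by (subst card_gt_0_iff) auto
    then have "real (?r l) powr (2 - \<alpha>) = real (?r l) powr (1 - \<alpha>) * real (?r l)"
      using powr_add[of "real (?r l)" "1 - \<alpha>" 1] by simp
    then show "Re l powr \<alpha> * real (?r l) powr (2 - \<alpha>)
      = (Re l powr \<alpha> * real (?r l) powr (1 - \<alpha>)) * of_nat (?r l)" by simp
  qed
  also have "\<dots> = (\<Sum>b<n. s b powr \<alpha> * block_size n s b powr (1 - \<alpha>))"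
    by (subst sum_group_values) (auto simp: block_size_def)
  finally show ?thesis
    unfolding catalytic_renyi_entropy_def spectrum_conj_real_diag[OF Q] trace_eigenprojector[OF Q]
    by simp
qed

text \<open>The test vector is column \<open>i\<close> of \<open>Q\<close>, a unit eigenvector at
  which the quadratic form takes the value \<open>d i\<close>.\<close>

lemma psd_conj_real_diag_nonneg:
  assumes Q: "unitary n Q" and psd: "psd n (Q * real_diag n d * mat_adjoint Q)" and i: "i < n"
  shows "0 \<le> d i"
proof -
  let ?A = "Q * real_diag n d * mat_adjoint Q"
  have Qc: "Q \<in> carrier_mat n n" using Q by (rule unitary_carrier)
  define v where "v = col Q i"
  have v: "v \<in> carrier_vec n" using Qc by (auto simp: v_def)
  have Av: "(?A *\<^sub>v v) $ j = complex_of_real (d i) * v $ j" if j: "j < n" for j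
  proof -
    have "(?A *\<^sub>v v) $ j = (\<Sum>k<n. \<Sum>m<n. complex_of_real (d m) * Q $$ (j, m) * cnj (Q $$ (k, m)) * Q $$ (k, i))"
      using Qc v i j by (simp add: mult_vec_entry[of _ n n] conj_real_diag_entry v_def sum_distrib_right)
    also have "\<dots> = (\<Sum>m<n. complex_of_real (d m) * Q $$ (j, m) * (\<Sum>k<n. cnj (Q $$ (k, m)) * Q $$ (k, i)))"
      by (subst sum.swap) (simp add: sum_distrib_left mult_ac)
    also have "\<dots> = complex_of_real (d i) * Q $$ (j, i)"
      using i by (simp add: unitary_cols[OF Q] mult_delta_right)
    finally show ?thesis using Qc i j by (simp add: v_def)
  qed
  have "(?A *\<^sub>v v) \<bullet>c v = (\<Sum>j<n. complex_of_real (d i) * v $ j * cnj (v $ j))"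
    unfolding cscalar_prod_entry[OF v] by (intro sum.cong refl) (simp add: Av)
  also have "\<dots> = complex_of_real (d i) * (\<Sum>j<n. cnj (Q $$ (j, i)) * Q $$ (j, i))"
    using Qc i by (simp add: v_def sum_distrib_left mult_ac)
  also have "\<dots> = complex_of_real (d i)" using i by (simp add: unitary_cols[OF Q])
  finally have "0 \<le> complex_of_real (d i)" using psd v unfolding psd_def by metis
  then show ?thesis by (simp add: less_eq_complex_def)
qed

lemma state_diagonalization:
  assumes "state n A"
  shows "\<exists>Q d. unitary n Q \<and> A = Q * real_diag n d * mat_adjoint Q \<and>
    (\<forall>i<n. 0 \<le> d i) \<and> (\<Sum>i<n. d i) = 1"
proof -
  have A: "psd n A" "trace A = 1" using assms by (auto simp: state_def)
  then obtain Q d where Q: "unitary n Q" and eq: "A = Q * real_diag n d * mat_adjoint Q"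
    using hermitian_diagonalization[of A n] by (auto simp: psd_def)
  have "complex_of_real (\<Sum>i<n. d i) = 1" using A(2) trace_conj_real_diag[OF Q, of d] by (simp add: eq)
  then have "(\<Sum>i<n. d i) = 1" by (metis of_real_eq_1_iff)
  then show ?thesis using Q eq psd_conj_real_diag_nonneg[OF Q] A(1) by blast
qed

section \<open>Power sums of an ensemble decomposition\<close>

text \<open>The right side is \<open>1 - \<alpha>\<close> times the tangent of
  \<open>t powr \<alpha>\<close> at \<open>x\<close>. The power is concave for \<alpha> < 1 and
  convex for \<alpha> > 1, and the factor \<open>1 - \<alpha>\<close> changes sign along with it.
  Both cases are Young's inequality: for \<open>t\<close> and \<open>x\<close> with weight \<alpha>,
  or for their powers with weight \<open>1 / \<alpha>\<close>.\<close>

lemma powr_tangent: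
  fixes \<alpha> t x :: real
  assumes "0 < \<alpha>" "\<alpha> \<noteq> 1" "0 \<le> t" "0 < x"
  shows "(1 - \<alpha>) * t powr \<alpha> \<le> (1 - \<alpha>) * ((1 - \<alpha>) * x powr \<alpha> + \<alpha> * x powr (\<alpha> - 1) * t)"
proof -
  \<comment> \<open>Young's inequality is applied to positive numbers only. At \<open>t = 0\<close>
    the left side is 0 and the right side is a square times \<open>x powr \<alpha>\<close>.\<close>
  consider "t = 0" | "0 < t" "\<alpha> < 1" | "0 < t" "\<not> \<alpha> < 1" using assms by linarith
  then show ?thesis
  proof cases
    case 1
    have "0 \<le> (1 - \<alpha>)\<^sup>2 * x powr \<alpha>" by simp
    with 1 show ?thesis by (simp add: power2_eq_square mult_ac)
  next
    case 2
    note t = 2(1) and True = 2(2)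
    have split: "x powr \<alpha> = x powr (\<alpha> - 1) * x" using assms powr_add[of x "\<alpha> - 1" 1] by simp
    have one: "x powr (\<alpha> - 1) * x powr (1 - \<alpha>) = 1" using assms by (simp flip: powr_add)
    have "t powr \<alpha> * x powr (1 - \<alpha>) \<le> \<alpha> * t + (1 - \<alpha>) * x"
      by (rule Youngs_inequality_0) (use True assms t in auto)
    then have "x powr (\<alpha> - 1) * (t powr \<alpha> * x powr (1 - \<alpha>)) \<le> x powr (\<alpha> - 1) * (\<alpha> * t + (1 - \<alpha>) * x)"
      by (rule mult_left_mono) simp
    also have "x powr (\<alpha> - 1) * (t powr \<alpha> * x powr (1 - \<alpha>)) = t powr \<alpha>"
      using one by (simp add: algebra_simps)
    finally have "t powr \<alpha> \<le> (1 - \<alpha>) * x powr \<alpha> + \<alpha> * x powr (\<alpha> - 1) * t"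
      by (simp add: split algebra_simps)
    then show ?thesis using True by (intro mult_left_mono) auto
  next
    case 3
    note t = 3(1) and False = 3(2)
    have "(t powr \<alpha>) powr (1 / \<alpha>) * (x powr \<alpha>) powr (1 - 1 / \<alpha>) \<le> 1 / \<alpha> * t powr \<alpha> + (1 - 1 / \<alpha>) * x powr \<alpha>"
      by (rule Youngs_inequality_0) (use False assms t in auto)
    moreover have "(t powr \<alpha>) powr (1 / \<alpha>) = t" "(x powr \<alpha>) powr (1 - 1 / \<alpha>) = x powr (\<alpha> - 1)"
      using assms by (auto simp: powr_powr right_diff_distrib)
    ultimately have "t * x powr (\<alpha> - 1) \<le> 1 / \<alpha> * t powr \<alpha> + (1 - 1 / \<alpha>) * x powr \<alpha>" by simp
    then have "\<alpha> * (t * x powr (\<alpha> - 1)) \<le> \<alpha> * (1 / \<alpha> * t powr \<alpha> + (1 - 1 / \<alpha>) * x powr \<alpha>)"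
      by (rule mult_left_mono) (use assms in simp)
    also have "\<dots> = t powr \<alpha> + (\<alpha> - 1) * x powr \<alpha>"
      using assms by (simp add: field_simps)
    finally have "(1 - \<alpha>) * x powr \<alpha> + \<alpha> * x powr (\<alpha> - 1) * t \<le> t powr \<alpha>"
      by (simp add: algebra_simps)
    then show ?thesis using False by (intro mult_left_mono_neg) auto
  qed
qed

text \<open>Average the tangent inequality at \<open>x\<close>. The normalization \<open>W\<close>
  of the mean is kept separate from the total weight \<open>sum w S\<close>, because Bessel's
  inequality will only bound the total weight by 1.\<close>

lemma powr_weighted_jensen:
  fixes \<alpha> :: real and w t :: "'a \<Rightarrow> real"
  assumes \<alpha>: "0 < \<alpha>" "\<alpha> \<noteq> 1" and x: "0 < x" and w: "\<And>i. i \<in> S \<Longrightarrow> 0 \<le> w i"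
    and t: "\<And>i. i \<in> S \<Longrightarrow> 0 \<le> t i" and mean: "(\<Sum>i\<in>S. w i * t i) = W * x"
  shows "(1 - \<alpha>) * (\<Sum>i\<in>S. w i * t i powr \<alpha>) \<le> (1 - \<alpha>) * (x powr \<alpha> * ((1 - \<alpha>) * sum w S + \<alpha> * W))"
proof -
  have lin: "(\<Sum>i\<in>S. w i * (a * (b + d * t i))) = a * (b * sum w S + d * (\<Sum>i\<in>S. w i * t i))" for a b d
    by (simp add: distrib_left sum.distrib sum_distrib_left mult_ac)
  have split: "x powr (\<alpha> - 1) * x = x powr \<alpha>" using x powr_add[of x "\<alpha> - 1" 1] by simp
  have "(1 - \<alpha>) * (\<Sum>i\<in>S. w i * t i powr \<alpha>) = (\<Sum>i\<in>S. w i * ((1 - \<alpha>) * t i powr \<alpha>))"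
    by (simp add: sum_distrib_left mult_ac)
  also have "\<dots> \<le> (\<Sum>i\<in>S. w i * ((1 - \<alpha>) * ((1 - \<alpha>) * x powr \<alpha> + \<alpha> * x powr (\<alpha> - 1) * t i)))"
    by (intro sum_mono mult_left_mono powr_tangent \<alpha> x w t)
  also have "\<dots> = (1 - \<alpha>) * ((1 - \<alpha>) * x powr \<alpha> * sum w S + \<alpha> * x powr (\<alpha> - 1) * (\<Sum>i\<in>S. w i * t i))"
    by (rule lin)
  also have "\<dots> = (1 - \<alpha>) * (x powr \<alpha> * ((1 - \<alpha>) * sum w S + \<alpha> * W))"
    unfolding mean split[symmetric] by (simp add: algebra_simps)
  finally show ?thesis .
qed

text \<open>Jensen with unit weights at the mean of \<open>t\<close>: for a given total, the uniform
  distribution is extremal. A vanishing total is treated separately because the tangent point must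
  be positive.\<close>

lemma sum_powr_le_card:
  fixes \<alpha> :: real and t :: "'a \<Rightarrow> real"
  assumes \<alpha>: "0 < \<alpha>" "\<alpha> \<noteq> 1" and S: "finite S" "S \<noteq> {}" and t: "\<And>i. i \<in> S \<Longrightarrow> 0 \<le> t i"
  shows "(1 - \<alpha>) * (\<Sum>i\<in>S. t i powr \<alpha>) \<le> (1 - \<alpha>) * (real (card S) powr (1 - \<alpha>) * sum t S powr \<alpha>)"
proof (cases "sum t S = 0")
  case True
  then have "t i = 0" if "i \<in> S" for i using that S t by (simp add: sum_nonneg_eq_0_iff)
  then show ?thesis using True by simp
next
  case False
  have N: "real (card S) > 0" using S by (simp add: card_gt_0_iff)
  have pos: "sum t S > 0" using False sum_nonneg[of S t] t by force
  define x where "x = sum t S / real (card S)"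
  have x: "x > 0" using pos N by (simp add: x_def)
  have "(1 - \<alpha>) * (\<Sum>i\<in>S. 1 * t i powr \<alpha>)
      \<le> (1 - \<alpha>) * (x powr \<alpha> * ((1 - \<alpha>) * (\<Sum>i\<in>S. 1) + \<alpha> * real (card S)))"
    by (rule powr_weighted_jensen) (use \<alpha> x t N in \<open>auto simp: x_def\<close>)
  also have "x powr \<alpha> * ((1 - \<alpha>) * (\<Sum>i\<in>S. 1) + \<alpha> * real (card S)) = real (card S) * x powr \<alpha>"
    by (simp add: algebra_simps)
  also have "\<dots> = real (card S) powr (1 - \<alpha>) * sum t S powr \<alpha>"
    using N pos by (simp add: x_def powr_divide powr_diff)
  finally show ?thesis by simp
qed

text \<open>Read \<open>c x m\<close> as coordinate \<open>x\<close> of the ensemble vector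
  \<open>m\<close> in the eigenbasis of the ensemble sum, whose eigenvalues are the
  \<open>t x\<close>. The weights \<open>w m x\<close> sum to 1 over \<open>m\<close> and to at most
  1 over \<open>x\<close>, and they average the \<open>t x\<close> to the squared norm
  \<open>N m\<close>. Jensen for each \<open>m\<close>, summed over \<open>m\<close>, gives the
  claim.\<close>

theorem ensemble_powr_ineq:
  fixes \<alpha> :: real and c :: "nat \<Rightarrow> 'a \<Rightarrow> complex" and t :: "nat \<Rightarrow> real"
  assumes \<alpha>: "0 < \<alpha>" "\<alpha> \<noteq> 1" and M: "finite M"
    and orth: "\<And>x y. x < D \<Longrightarrow> y < D \<Longrightarrow>
      (\<Sum>m\<in>M. c x m * cnj (c y m)) = (if x = y then complex_of_real (t x) else 0)"
  shows "(1 - \<alpha>) * (\<Sum>x<D. t x powr \<alpha>) \<le> (1 - \<alpha>) * (\<Sum>m\<in>M. (\<Sum>x<D. (cmod (c x m))\<^sup>2) powr \<alpha>)"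
proof -
  have t_eq: "t x = (\<Sum>m\<in>M. (cmod (c x m))\<^sup>2)" if "x < D" for x
  proof -
    have "complex_of_real (t x) = complex_of_real (\<Sum>m\<in>M. (cmod (c x m))\<^sup>2)"
      using orth[OF that that] by (simp add: complex_norm_square[symmetric])
    then show ?thesis by (simp only: of_real_eq_iff)
  qed
  \<comment> \<open>A row \<open>x\<close> with \<open>t x = 0\<close> vanishes identically, so only
    rows in \<open>P\<close> matter, and there division by \<open>t x\<close> is safe.\<close>
  define P where "P = {x \<in> {..<D}. t x > 0}"
  have P: "finite P" "\<And>x. x \<in> P \<Longrightarrow> x < D" "\<And>x. x \<in> P \<Longrightarrow> t x > 0" by (auto simp: P_def)
  have t0: "t x = 0" if "x < D" "x \<notin> P" for x
    using that t_eq[OF that(1)] sum_nonneg[of M "\<lambda>m. (cmod (c x m))\<^sup>2"] by (auto simp: P_def)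
  have c0: "c x m = 0" if "x < D" "x \<notin> P" "m \<in> M" for x m
    using t0[OF that(1,2)] t_eq[OF that(1)] M that(3) by (simp add: sum_nonneg_eq_0_iff)
  define w where "w m x = (cmod (c x m))\<^sup>2 / t x" for m x
  have w_nonneg: "0 \<le> w m x" if "x \<in> P" for m x using P(3)[OF that] by (simp add: w_def)
  \<comment> \<open>Bessel's inequality for the orthonormal rows \<open>c x / sqrt (t x)\<close>\<close>
  have bessel: "sum (w m) P \<le> 1" if m: "m \<in> M" for m
  proof -
    \<comment> \<open>\<open>y\<close> is the orthogonal projection of the \<open>m\<close>-th
      standard basis vector onto the span of the rows. Its squared norm equals its own coordinate
      \<open>y m\<close>, which is the total weight; hence the square of the total weight is at most
      the total weight.\<close>
    define y where "y k = (\<Sum>x\<in>P. cnj (c x m) * c x k / complex_of_real (t x))" for k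
    have "(\<Sum>k\<in>M. y k * cnj (y k)) = (\<Sum>k\<in>M. \<Sum>x\<in>P. \<Sum>x'\<in>P.
        cnj (c x m) * c x' m / (complex_of_real (t x) * complex_of_real (t x')) * (c x k * cnj (c x' k)))"
      by (simp add: y_def sum_product mult_ac)
    also have "\<dots> = (\<Sum>x\<in>P. \<Sum>x'\<in>P. cnj (c x m) * c x' m /
        (complex_of_real (t x) * complex_of_real (t x')) * (\<Sum>k\<in>M. c x k * cnj (c x' k)))"
      unfolding sum_distrib_left by (subst sum.swap, intro sum.cong refl, rule sum.swap)
    also have "\<dots> = (\<Sum>x\<in>P. cnj (c x m) * c x m / complex_of_real (t x))"
    proof (rule sum.cong[OF refl])
      fix x assume x: "x \<in> P"
      have "(\<Sum>x'\<in>P. cnj (c x m) * c x' m / (complex_of_real (t x) * complex_of_real (t x')) *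
          (\<Sum>k\<in>M. c x k * cnj (c x' k)))
        = (\<Sum>x'\<in>P. if x' = x then cnj (c x m) * c x m / complex_of_real (t x) else 0)"
        using P x by (intro sum.cong refl) (auto simp: orth)
      then show "(\<Sum>x'\<in>P. cnj (c x m) * c x' m / (complex_of_real (t x) * complex_of_real (t x')) *
          (\<Sum>k\<in>M. c x k * cnj (c x' k))) = cnj (c x m) * c x m / complex_of_real (t x)"
        using P x by simp
    qed
    also have "\<dots> = y m" by (simp add: y_def)
    finally have yy: "(\<Sum>k\<in>M. y k * cnj (y k)) = y m" .
    have ym: "y m = complex_of_real (sum (w m) P)"
      unfolding y_def w_def of_real_sum of_real_divide complex_norm_square
      by (simp add: mult.commute)
    have "complex_of_real (\<Sum>k\<in>M. (cmod (y k))\<^sup>2) = complex_of_real (sum (w m) P)"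
      using yy unfolding ym[symmetric] by (simp only: of_real_sum complex_norm_square)
    then have "(\<Sum>k\<in>M. (cmod (y k))\<^sup>2) = sum (w m) P" by (simp only: of_real_eq_iff)
    moreover have "(cmod (y m))\<^sup>2 \<le> (\<Sum>k\<in>M. (cmod (y k))\<^sup>2)"
      by (rule member_le_sum) (use m M in auto)
    moreover have "(cmod (y m))\<^sup>2 = (sum (w m) P)\<^sup>2"
      unfolding ym norm_of_real by simp
    ultimately have "sum (w m) P * sum (w m) P \<le> sum (w m) P" by (simp add: power2_eq_square)
    moreover have "0 \<le> sum (w m) P" by (intro sum_nonneg w_nonneg)
    ultimately show ?thesis by (auto simp: mult_le_cancel_left2)
  qed
  define N where "N m = (\<Sum>x<D. (cmod (c x m))\<^sup>2)" for m
  have N_P: "N m = (\<Sum>x\<in>P. w m x * t x)" if m: "m \<in> M" for m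
  proof -
    have "N m = (\<Sum>x\<in>P. (cmod (c x m))\<^sup>2)"
      unfolding N_def using P c0 m by (intro sum.mono_neutral_right) auto
    then show ?thesis using P(3) by (simp add: w_def less_imp_neq[symmetric])
  qed
  have step: "(1 - \<alpha>) * (\<Sum>x\<in>P. w m x * t x powr \<alpha>) \<le> (1 - \<alpha>) * N m powr \<alpha>" if m: "m \<in> M" for m
  proof (cases "N m = 0")
    case True
    then have "c x m = 0" if "x < D" for x
      using that by (simp add: N_def sum_nonneg_eq_0_iff)
    then show ?thesis using True P(2) by (simp add: w_def)
  next
    case False
    then have pos: "N m > 0" using sum_nonneg[of "{..<D}" "\<lambda>x. (cmod (c x m))\<^sup>2"] by (force simp: N_def)
    have "(1 - \<alpha>) * (\<Sum>x\<in>P. w m x * t x powr \<alpha>)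
        \<le> (1 - \<alpha>) * (N m powr \<alpha> * ((1 - \<alpha>) * sum (w m) P + \<alpha> * 1))"
      by (rule powr_weighted_jensen)
        (use \<alpha> pos w_nonneg P(3) N_P[OF m] in \<open>auto simp: less_imp_le\<close>)
    \<comment> \<open>The missing weight \<open>1 - sum (w m) P\<close> enters with the factor
      \<open>(1 - \<alpha>)\<^sup>2\<close>, so discarding it goes in the right direction for either
      sign of \<open>1 - \<alpha>\<close>.\<close>
    also have "\<dots> = (1 - \<alpha>) * N m powr \<alpha> - (1 - \<alpha>)\<^sup>2 * N m powr \<alpha> * (1 - sum (w m) P)"
      by (simp add: power2_eq_square algebra_simps)
    also have "\<dots> \<le> (1 - \<alpha>) * N m powr \<alpha>" using bessel[OF m] by simp
    finally show ?thesis .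
  qed
  have "(\<Sum>x<D. t x powr \<alpha>) = (\<Sum>x\<in>P. t x powr \<alpha>)"
    using t0 P(1,2) by (intro sum.mono_neutral_right) auto
  also have "\<dots> = (\<Sum>x\<in>P. (\<Sum>m\<in>M. w m x) * t x powr \<alpha>)"
  proof (rule sum.cong[OF refl])
    fix x assume x: "x \<in> P"
    have "(\<Sum>m\<in>M. w m x) = 1"
      using P(3)[OF x] t_eq[OF P(2)[OF x]] by (simp add: w_def flip: sum_divide_distrib)
    then show "t x powr \<alpha> = (\<Sum>m\<in>M. w m x) * t x powr \<alpha>" by simp
  qed
  also have "\<dots> = (\<Sum>m\<in>M. \<Sum>x\<in>P. w m x * t x powr \<alpha>)"
    unfolding sum_distrib_right by (rule sum.swap)
  finally have "(1 - \<alpha>) * (\<Sum>x<D. t x powr \<alpha>) = (\<Sum>m\<in>M. (1 - \<alpha>) * (\<Sum>x\<in>P. w m x * t x powr \<alpha>))"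
    by (simp add: sum_distrib_left)
  also have "\<dots> \<le> (\<Sum>m\<in>M. (1 - \<alpha>) * N m powr \<alpha>)" by (intro sum_mono step)
  finally show ?thesis by (simp add: N_def sum_distrib_left)
qed

section \<open>Bipartite systems\<close>

lemma pair_index_less: "a < d \<Longrightarrow> p < n \<Longrightarrow> a * n + p < d * (n :: nat)"
proof -
  assume "a < d" "p < n"
  then have "a * n + p < Suc a * n" by simp
  also have "\<dots> \<le> d * n" using \<open>a < d\<close> by (intro mult_right_mono) auto
  finally show ?thesis .
qed

lemma pair_index_split:
  assumes "i < d * (n :: nat)"
  obtains a p where "a < d" "p < n" "i = a * n + p"
proof
  have n: "n > 0" using assms by (cases n) auto
  show "i div n < d" using assms by (simp add: less_mult_imp_div_less)
  show "i mod n < n" using n by simp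
  show "i = i div n * n + i mod n" by simp
qed

lemma sum_pair_index:
  fixes f :: "nat \<Rightarrow> 'a :: comm_monoid_add"
  shows "(\<Sum>k<d * n. f k) = (\<Sum>a<d. \<Sum>p<n. f (a * n + p))"
proof (induction d)
  case (Suc d)
  have split: "(\<Sum>k<m + l. f k) = (\<Sum>k<m. f k) + (\<Sum>p<l. f (m + p))" for m l
    by (induction l) (auto simp: add.assoc)
  have "(\<Sum>k<Suc d * n. f k) = (\<Sum>k<d * n + n. f k)" by (simp add: add.commute)
  also have "\<dots> = (\<Sum>k<d * n. f k) + (\<Sum>p<n. f (d * n + p))"
    by (rule split)
  finally show ?case using Suc by simp
qed simp

lemma eq_mat_pair_index:
  assumes "A \<in> carrier_mat (d * n) (d * n)" "B \<in> carrier_mat (d * n) (d * n)"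
    and "\<And>a p a' q. a < d \<Longrightarrow> p < n \<Longrightarrow> a' < d \<Longrightarrow> q < n \<Longrightarrow>
      A $$ (a * n + p, a' * n + q) = B $$ (a * n + p, a' * n + q)"
  shows "A = B"
proof (rule eq_matI)
  fix i j assume "i < dim_row B" "j < dim_col B"
  then have "i < d * n" "j < d * n" using assms by auto
  then show "A $$ (i, j) = B $$ (i, j)"
    by (elim pair_index_split) (simp add: assms(3))
qed (use assms in auto)

lemma mult_pair_entry:
  assumes "A \<in> carrier_mat (d * n) (d * n)" "B \<in> carrier_mat (d * n) (d * n)"
    "a < d" "p < n" "a' < d" "q < n"
  shows "(A * B) $$ (a * n + p, a' * n + q)
    = (\<Sum>x<d. \<Sum>b<n. A $$ (a * n + p, x * n + b) * B $$ (x * n + b, a' * n + q))"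
  using assms by (simp add: mult_entry[of _ "d * n" "d * n" _ "d * n"] pair_index_less sum_pair_index)

lemma adjoint_pair_entry:
  fixes A :: "complex mat"
  assumes "A \<in> carrier_mat (d * n) (d * n)" "a < d" "p < n" "a' < d" "q < n"
  shows "mat_adjoint A $$ (a * n + p, a' * n + q) = cnj (A $$ (a' * n + q, a * n + p))"
  using assms by (intro mat_adjoint_entry) (auto simp: pair_index_less)

lemma tensor_carrier [simp]:
  "A \<in> carrier_mat d d \<Longrightarrow> B \<in> carrier_mat n n \<Longrightarrow> tensor A B \<in> carrier_mat (d * n) (d * n)"
  by (intro carrier_matI) (auto simp: tensor_def)

lemma tensor_entry:
  assumes "A \<in> carrier_mat d d" "B \<in> carrier_mat n n" "a < d" "p < n" "a' < d" "q < n"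
  shows "tensor A B $$ (a * n + p, a' * n + q) = A $$ (a, a') * B $$ (p, q)"
  using assms by (simp add: tensor_def pair_index_less)

lemma tensor_mult:
  assumes "A \<in> carrier_mat d d" "B \<in> carrier_mat n n" "C \<in> carrier_mat d d" "E \<in> carrier_mat n n"
  shows "tensor A B * tensor C E = tensor (A * C) (B * E)"
proof (rule eq_mat_pair_index[of _ d n])
  fix a p a' q assume i: "a < d" "p < n" "a' < d" "q < n"
  show "(tensor A B * tensor C E) $$ (a * n + p, a' * n + q)
    = tensor (A * C) (B * E) $$ (a * n + p, a' * n + q)"
    using assms i
    by (simp add: mult_pair_entry[of _ d n] tensor_entry[of _ d _ n] mult_entry[of _ d d _ d]
        mult_entry[of _ n n _ n] sum_product mult_ac)
qed (use assms in auto)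

lemma tensor_adjoint:
  assumes "A \<in> carrier_mat d d" "B \<in> carrier_mat n n"
  shows "mat_adjoint (tensor A B) = tensor (mat_adjoint A) (mat_adjoint B)"
  by (rule eq_mat_pair_index[of _ d n])
    (use assms in \<open>auto simp: adjoint_pair_entry[of _ d n] tensor_entry[of _ d _ n]
      mat_adjoint_entry[of _ d d] mat_adjoint_entry[of _ n n]\<close>)

lemma tensor_one: "tensor (1\<^sub>m d) (1\<^sub>m n) = 1\<^sub>m (d * n)"
proof (rule eq_mat_pair_index[of _ d n])
  fix a p a' q assume i: "a < d" "p < n" "a' < d" "q < n"
  then have "a * n + p = a' * n + q \<longleftrightarrow> a = a' \<and> p = q"
    by (metis div_mult_self3 div_less mod_mult_self3 mod_less add_0_right less_nat_zero_code)
  then show "tensor (1\<^sub>m d) (1\<^sub>m n) $$ (a * n + p, a' * n + q) = 1\<^sub>m (d * n) $$ (a * n + p, a' * n + q)"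
    using i by (auto simp: tensor_entry[of _ d _ n] pair_index_less)
qed auto

lemma unitary_tensor:
  assumes "unitary d A" "unitary n B"
  shows "unitary (d * n) (tensor A B)"
  using assms by (intro unitaryI) (auto simp: unitary_def tensor_adjoint tensor_mult[of _ d _ n] tensor_one)

lemma local_conj_entry:
  assumes W: "W \<in> carrier_mat n n" and X: "X \<in> carrier_mat (d * n) (d * n)"
    and i: "a < d" "p < n" "a' < d" "q < n"
  shows "(tensor (1\<^sub>m d) W * X * mat_adjoint (tensor (1\<^sub>m d) W)) $$ (a * n + p, a' * n + q)
    = (\<Sum>c<n. \<Sum>b<n. W $$ (p, b) * X $$ (a * n + b, a' * n + c) * cnj (W $$ (q, c)))"
proof -
  have T: "tensor (1\<^sub>m d) W \<in> carrier_mat (d * n) (d * n)" using W by simp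
  have delta: "(\<Sum>x<d. \<Sum>b<n. (1\<^sub>m d $$ (r, x) * f b :: complex) * g x b) = (\<Sum>b<n. f b * g r b)"
    if "r < d" for f g r
  proof -
    have "(\<Sum>x<d. \<Sum>b<n. (1\<^sub>m d $$ (r, x) * f b) * g x b)
      = (\<Sum>x<d. if x = r then \<Sum>b<n. f b * g x b else 0)"
      using that by (intro sum.cong refl) auto
    then show ?thesis using that by simp
  qed
  have "(tensor (1\<^sub>m d) W * X) $$ (a * n + p, x * n + c) = (\<Sum>b<n. W $$ (p, b) * X $$ (a * n + b, x * n + c))"
    if "x < d" "c < n" for x c
  proof -
    have "(tensor (1\<^sub>m d) W * X) $$ (a * n + p, x * n + c)
      = (\<Sum>x'<d. \<Sum>b<n. (1\<^sub>m d $$ (a, x') * W $$ (p, b)) * X $$ (x' * n + b, x * n + c))"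
      using W X T i that by (subst mult_pair_entry[of _ d n])
        (auto simp: tensor_entry[of _ d _ n] simp del: index_one_mat intro!: sum.cong)
    then show ?thesis using delta[OF i(1)] by simp
  qed
  then have "(tensor (1\<^sub>m d) W * X * mat_adjoint (tensor (1\<^sub>m d) W)) $$ (a * n + p, a' * n + q)
    = (\<Sum>x<d. \<Sum>c<n. (1\<^sub>m d $$ (a', x) * cnj (W $$ (q, c))) *
        (\<Sum>b<n. W $$ (p, b) * X $$ (a * n + b, x * n + c)))"
    using W X T i by (subst mult_pair_entry[of _ d n])
      (auto simp: adjoint_pair_entry[of _ d n] tensor_entry[of _ d _ n] intro!: sum.cong)
  also have "\<dots> = (\<Sum>c<n. cnj (W $$ (q, c)) * (\<Sum>b<n. W $$ (p, b) * X $$ (a * n + b, a' * n + c)))"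
    by (rule delta[OF i(3)])
  finally show ?thesis by (simp add: sum_distrib_left mult_ac)
qed

section \<open>Partial traces and conjugation by local operators\<close>

lemma ptrace1_carrier [simp]: "ptrace1 d n X \<in> carrier_mat n n"
  by (simp add: ptrace1_def)

lemma ptrace2_carrier [simp]: "ptrace2 d n X \<in> carrier_mat d d"
  by (simp add: ptrace2_def)

lemma dim_ptrace [simp]:
  "dim_row (ptrace1 d n X) = n" "dim_col (ptrace1 d n X) = n"
  "dim_row (ptrace2 d n X) = d" "dim_col (ptrace2 d n X) = d"
  by (simp_all add: ptrace1_def ptrace2_def)

lemma ptrace1_local_conj:
  assumes W: "W \<in> carrier_mat n n" and X: "X \<in> carrier_mat (d * n) (d * n)"
  shows "ptrace1 d n (tensor (1\<^sub>m d) W * X * mat_adjoint (tensor (1\<^sub>m d) W))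
    = W * ptrace1 d n X * mat_adjoint W"
proof (rule eq_matI)
  fix i j assume "i < dim_row (W * ptrace1 d n X * mat_adjoint W)"
    "j < dim_col (W * ptrace1 d n X * mat_adjoint W)"
  then have ij: "i < n" "j < n" using W by auto
  have "(W * ptrace1 d n X * mat_adjoint W) $$ (i, j)
    = (\<Sum>c<n. \<Sum>b<n. \<Sum>a<d. W $$ (i, b) * X $$ (a * n + b, a * n + c) * cnj (W $$ (j, c)))"
    using W ij by (subst mult_entry[of _ n n _ n])
      (auto simp: mult_entry[of _ n n _ n] mat_adjoint_entry ptrace1_def sum_distrib_left
        sum_distrib_right intro!: sum.cong)
  also have "\<dots> = (\<Sum>c<n. \<Sum>a<d. \<Sum>b<n. W $$ (i, b) * X $$ (a * n + b, a * n + c) * cnj (W $$ (j, c)))"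
    by (intro sum.cong refl sum.swap)
  also have "\<dots> = (\<Sum>a<d. \<Sum>c<n. \<Sum>b<n. W $$ (i, b) * X $$ (a * n + b, a * n + c) * cnj (W $$ (j, c)))"
    by (rule sum.swap)
  also have "\<dots> = ptrace1 d n (tensor (1\<^sub>m d) W * X * mat_adjoint (tensor (1\<^sub>m d) W)) $$ (i, j)"
    using ij by (simp add: ptrace1_def local_conj_entry[OF W X])
  finally show "ptrace1 d n (tensor (1\<^sub>m d) W * X * mat_adjoint (tensor (1\<^sub>m d) W)) $$ (i, j)
    = (W * ptrace1 d n X * mat_adjoint W) $$ (i, j)" ..
qed (use W in auto)

text \<open>\<open>W\<close> acts on the factor that is traced out, where orthonormality of its
  columns cancels it.\<close>

lemma ptrace2_local_conj:
  assumes W: "unitary n W" and X: "X \<in> carrier_mat (d * n) (d * n)"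
  shows "ptrace2 d n (tensor (1\<^sub>m d) W * X * mat_adjoint (tensor (1\<^sub>m d) W)) = ptrace2 d n X"
proof (rule eq_matI)
  have Wc: "W \<in> carrier_mat n n" using W by (rule unitary_carrier)
  fix i j assume "i < dim_row (ptrace2 d n X)" "j < dim_col (ptrace2 d n X)"
  then have ij: "i < d" "j < d" by (auto simp: ptrace2_def)
  have "ptrace2 d n (tensor (1\<^sub>m d) W * X * mat_adjoint (tensor (1\<^sub>m d) W)) $$ (i, j)
    = (\<Sum>p<n. \<Sum>c<n. \<Sum>b<n. W $$ (p, b) * X $$ (i * n + b, j * n + c) * cnj (W $$ (p, c)))"
    using ij by (simp add: ptrace2_def local_conj_entry[OF Wc X])
  also have "\<dots> = (\<Sum>c<n. \<Sum>p<n. \<Sum>b<n. W $$ (p, b) * X $$ (i * n + b, j * n + c) * cnj (W $$ (p, c)))"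
    by (rule sum.swap)
  also have "\<dots> = (\<Sum>c<n. \<Sum>b<n. \<Sum>p<n. W $$ (p, b) * X $$ (i * n + b, j * n + c) * cnj (W $$ (p, c)))"
    by (intro sum.cong refl sum.swap)
  also have "\<dots> = (\<Sum>c<n. \<Sum>b<n. X $$ (i * n + b, j * n + c) * (\<Sum>p<n. cnj (W $$ (p, c)) * W $$ (p, b)))"
    by (simp add: sum_distrib_left mult_ac)
  also have "\<dots> = (\<Sum>c<n. X $$ (i * n + c, j * n + c))"
    by (intro sum.cong refl) (simp add: unitary_cols[OF W] mult_delta_right)
  also have "\<dots> = ptrace2 d n X $$ (i, j)" using ij by (simp add: ptrace2_def)
  finally show "ptrace2 d n (tensor (1\<^sub>m d) W * X * mat_adjoint (tensor (1\<^sub>m d) W)) $$ (i, j)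
    = ptrace2 d n X $$ (i, j)" .
qed (auto simp: ptrace2_def)

text \<open>A matrix \<open>R\<close> on the catalyst before \<open>U\<close> rotates the incoming
  catalyst state, and \<open>W\<close> after \<open>U\<close> conjugates the joint output. This is
  the passage between a general catalyst and its diagonal form, in both directions of the
  theorem.\<close>

lemma local_conj_dilation:
  assumes c: "W \<in> carrier_mat n n" "R \<in> carrier_mat n n" "\<sigma> \<in> carrier_mat n n"
    "U \<in> carrier_mat (d * n) (d * n)" "X \<in> carrier_mat d d"
  defines "U' \<equiv> tensor (1\<^sub>m d) W * U * tensor (1\<^sub>m d) R"
  shows "U' * tensor X \<sigma> * mat_adjoint U' = tensor (1\<^sub>m d) W *
    (U * tensor X (R * \<sigma> * mat_adjoint R) * mat_adjoint U) * mat_adjoint (tensor (1\<^sub>m d) W)"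
proof -
  let ?m = "d * n"
  define T S Y where "T = tensor (1\<^sub>m d) W" and "S = tensor (1\<^sub>m d) R" and "Y = tensor X \<sigma>"
  have T: "T \<in> carrier_mat ?m ?m" "S \<in> carrier_mat ?m ?m" "Y \<in> carrier_mat ?m ?m"
    using c by (auto simp: T_def S_def Y_def)
  have "tensor X (R * \<sigma> * mat_adjoint R) = S * Y * mat_adjoint S"
    using c by (simp add: S_def Y_def tensor_adjoint[of _ d _ n] tensor_mult[of _ d _ n])
  then show ?thesis
    unfolding U'_def T_def[symmetric] S_def[symmetric] Y_def[symmetric]
    using T c by (simp add: mat_adjoint_mult[of _ ?m ?m _ ?m] assoc_mult_mat[of _ ?m ?m _ ?m _ ?m])
qed

lemma dilation_entry:
  assumes U: "U \<in> carrier_mat (d * n) (d * n)" and X: "X \<in> carrier_mat d d"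
    and i: "a < d" "p < n" "a' < d" "q < n"
  shows "(U * tensor X (real_diag n s) * mat_adjoint U) $$ (a * n + p, a' * n + q)
    = (\<Sum>b<n. \<Sum>x<d. \<Sum>y<d. complex_of_real (s b) * U $$ (a * n + p, x * n + b) * X $$ (x, y) *
        cnj (U $$ (a' * n + q, y * n + b)))"
proof -
  have T: "tensor X (real_diag n s) \<in> carrier_mat (d * n) (d * n)" using X by simp
  have 1: "(U * tensor X (real_diag n s)) $$ (a * n + p, y * n + b)
    = (\<Sum>x<d. U $$ (a * n + p, x * n + b) * X $$ (x, y) * complex_of_real (s b))" if "y < d" "b < n" for y b
    using U X T i that by (simp add: mult_pair_entry[of _ d n] tensor_entry[of _ d _ n]
        mult_delta_right mult.assoc)
  have "(U * tensor X (real_diag n s) * mat_adjoint U) $$ (a * n + p, a' * n + q)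
    = (\<Sum>y<d. \<Sum>b<n. \<Sum>x<d. complex_of_real (s b) * U $$ (a * n + p, x * n + b) * X $$ (x, y) *
        cnj (U $$ (a' * n + q, y * n + b)))"
    using U X T i by (subst mult_pair_entry[of _ d n])
      (auto simp: adjoint_pair_entry[of _ d n] 1 sum_distrib_left mult_ac intro!: sum.cong)
  also have "\<dots> = (\<Sum>b<n. \<Sum>y<d. \<Sum>x<d. complex_of_real (s b) * U $$ (a * n + p, x * n + b) * X $$ (x, y) *
        cnj (U $$ (a' * n + q, y * n + b)))"
    by (rule sum.swap)
  also have "\<dots> = (\<Sum>b<n. \<Sum>x<d. \<Sum>y<d. complex_of_real (s b) * U $$ (a * n + p, x * n + b) * X $$ (x, y) *
        cnj (U $$ (a' * n + q, y * n + b)))"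
    by (intro sum.cong refl sum.swap)
  finally show ?thesis .
qed

lemma unitary_parseval:
  assumes "unitary n U"
  shows "(\<Sum>k<n. (cmod (\<Sum>x<n. U $$ (k, x) * v x))\<^sup>2) = (\<Sum>x<n. (cmod (v x))\<^sup>2)"
proof -
  have "complex_of_real (\<Sum>k<n. (cmod (\<Sum>x<n. U $$ (k, x) * v x))\<^sup>2)
    = (\<Sum>k<n. \<Sum>x<n. \<Sum>y<n. v x * cnj (v y) * (cnj (U $$ (k, y)) * U $$ (k, x)))"
    unfolding of_real_sum complex_norm_square by (simp add: sum_product mult_ac)
  also have "\<dots> = (\<Sum>x<n. \<Sum>y<n. v x * cnj (v y) * (\<Sum>k<n. cnj (U $$ (k, y)) * U $$ (k, x)))"
    unfolding sum_distrib_left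
    by (rule trans[OF sum.swap], intro sum.cong refl sum.swap)
  also have "\<dots> = (\<Sum>x<n. v x * cnj (v x))"
    by (intro sum.cong refl) (simp add: unitary_cols[OF assms] mult_delta_right)
  also have "\<dots> = complex_of_real (\<Sum>x<n. (cmod (v x))\<^sup>2)"
    unfolding of_real_sum complex_norm_square ..
  finally show ?thesis by (simp only: of_real_eq_iff)
qed

text \<open>In the eigenbasis given by \<open>T\<close>, the coordinate rows of the ensemble become
  orthogonal with squared norms \<open>t x\<close>, as \<open>ensemble_powr_ineq\<close> demands.
  Parseval's identity converts the norms of the vectors back.\<close>

lemma ensemble_spectrum_powr_ineq:
  assumes \<alpha>: "0 < \<alpha>" "\<alpha> \<noteq> 1" and M: "finite M" and T: "unitary n T"
    and ens: "\<And>i j. i < n \<Longrightarrow> j < n \<Longrightarrow>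
      (T * real_diag n t * mat_adjoint T) $$ (i, j) = (\<Sum>m\<in>M. w m i * cnj (w m j))"
  shows "(1 - \<alpha>) * (\<Sum>x<n. t x powr \<alpha>) \<le> (1 - \<alpha>) * (\<Sum>m\<in>M. (\<Sum>i<n. (cmod (w m i))\<^sup>2) powr \<alpha>)"
proof -
  define c where "c x m = (\<Sum>i<n. mat_adjoint T $$ (x, i) * w m i)" for x m
  have Tc: "T \<in> carrier_mat n n" using T by (rule unitary_carrier)
  have "(\<Sum>m\<in>M. c x m * cnj (c y m)) = (if x = y then complex_of_real (t x) else 0)"
    if xy: "x < n" "y < n" for x y
  proof -
    have "(\<Sum>m\<in>M. c x m * cnj (c y m))
      = (\<Sum>m\<in>M. \<Sum>i<n. \<Sum>j<n. cnj (T $$ (i, x)) * T $$ (j, y) * (w m i * cnj (w m j)))"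
      using xy by (simp add: c_def mat_adjoint_entry[OF Tc] sum_product mult_ac)
    also have "\<dots> = (\<Sum>i<n. \<Sum>j<n. cnj (T $$ (i, x)) * T $$ (j, y) * (\<Sum>m\<in>M. w m i * cnj (w m j)))"
      unfolding sum_distrib_left by (subst sum.swap, intro sum.cong refl, rule sum.swap)
    also have "\<dots> = (\<Sum>i<n. \<Sum>j<n. \<Sum>k<n. cnj (T $$ (i, x)) * T $$ (j, y) *
        (complex_of_real (t k) * T $$ (i, k) * cnj (T $$ (j, k))))"
      by (intro sum.cong refl) (simp add: ens[symmetric] conj_real_diag_entry[OF Tc] sum_distrib_left)
    also have "\<dots> = (\<Sum>i<n. \<Sum>k<n. \<Sum>j<n. cnj (T $$ (i, x)) * T $$ (j, y) *
        (complex_of_real (t k) * T $$ (i, k) * cnj (T $$ (j, k))))"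
      by (intro sum.cong refl sum.swap)
    also have "\<dots> = (\<Sum>k<n. \<Sum>i<n. \<Sum>j<n. cnj (T $$ (i, x)) * T $$ (j, y) *
        (complex_of_real (t k) * T $$ (i, k) * cnj (T $$ (j, k))))"
      by (rule sum.swap)
    also have "\<dots> = (\<Sum>k<n. complex_of_real (t k) * ((\<Sum>i<n. cnj (T $$ (i, x)) * T $$ (i, k)) *
        (\<Sum>j<n. cnj (T $$ (j, k)) * T $$ (j, y))))"
      unfolding sum_product unfolding sum_distrib_left
      by (intro sum.cong refl) (simp add: mult_ac)
    also have "\<dots> = (\<Sum>k<n. if k = x then (if x = y then complex_of_real (t x) else 0) else 0)"
      using xy by (intro sum.cong refl) (auto simp: unitary_cols[OF T])
    finally show ?thesis using xy by simp
  qed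
  from ensemble_powr_ineq[where D = n and t = t and c = c, OF \<alpha> M this]
  have "(1 - \<alpha>) * (\<Sum>x<n. t x powr \<alpha>) \<le> (1 - \<alpha>) * (\<Sum>m\<in>M. (\<Sum>x<n. (cmod (c x m))\<^sup>2) powr \<alpha>)" .
  then show ?thesis unfolding c_def unitary_parseval[OF unitary_adjoint[OF T]] .
qed

section \<open>Channels dilated by a diagonal catalyst\<close>

text \<open>The quadratic form at \<open>v\<close> is the sum over \<open>m\<close> of the squared
  moduli of the inner products of \<open>v\<close> with \<open>w m\<close>.\<close>

lemma psd_ensemble:
  assumes A: "A \<in> carrier_mat n n" and ens: "\<And>i j. i < n \<Longrightarrow> j < n \<Longrightarrow> A $$ (i, j) = (\<Sum>m\<in>M. w m i * cnj (w m j))"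
  shows "psd n A"
  unfolding psd_def hermitian_def
proof (intro conjI ballI A)
  show "mat_adjoint A = A"
    by (rule eq_matI) (use A in \<open>auto simp: mat_adjoint_entry[OF A] ens mult.commute\<close>)
  fix v :: "complex vec" assume v: "v \<in> carrier_vec n"
  have "(A *\<^sub>v v) \<bullet>c v = (\<Sum>i<n. \<Sum>j<n. \<Sum>m\<in>M. (cnj (v $ i) * w m i) * cnj (cnj (v $ j) * w m j))"
    using A v by (simp add: cscalar_prod_entry mult_vec_entry ens sum_distrib_left mult_ac)
  also have "\<dots> = (\<Sum>i<n. \<Sum>m\<in>M. \<Sum>j<n. (cnj (v $ i) * w m i) * cnj (cnj (v $ j) * w m j))"
    by (intro sum.cong refl sum.swap)
  also have "\<dots> = (\<Sum>m\<in>M. \<Sum>i<n. \<Sum>j<n. (cnj (v $ i) * w m i) * cnj (cnj (v $ j) * w m j))"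
    by (rule sum.swap)
  also have "\<dots> = (\<Sum>m\<in>M. (\<Sum>i<n. cnj (v $ i) * w m i) * cnj (\<Sum>i<n. cnj (v $ i) * w m i))"
    unfolding cnj_sum sum_product ..
  also have "\<dots> = complex_of_real (\<Sum>m\<in>M. (cmod (\<Sum>i<n. cnj (v $ i) * w m i))\<^sup>2)"
    unfolding of_real_sum complex_norm_square ..
  also have "0 \<le> \<dots>" by (auto simp: less_eq_complex_def intro!: sum_nonneg)
  finally show "0 \<le> (A *\<^sub>v v) \<bullet>c v" .
qed

lemma psd_diagonalization:
  assumes "psd n A"
  shows "\<exists>Q d. unitary n Q \<and> A = Q * real_diag n d * mat_adjoint Q \<and> (\<forall>i<n. 0 \<le> d i)"
proof -
  obtain Q d where Q: "unitary n Q" and eq: "A = Q * real_diag n d * mat_adjoint Q"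
    using hermitian_diagonalization[of A n] assms by (auto simp: psd_def)
  then show ?thesis using psd_conj_real_diag_nonneg[OF Q] assms by blast
qed

lemma state_real_diag:
  assumes "\<And>i. i < n \<Longrightarrow> 0 \<le> d i" "(\<Sum>i<n. d i) = 1"
  shows "state n (real_diag n d)"
proof -
  have "psd n (real_diag n d)"
    by (rule psd_ensemble[where M = "{..<n}" and w = "\<lambda>m i. if m = i then complex_of_real (sqrt (d i)) else 0"])
      (use assms in \<open>auto simp: mult_delta_left simp flip: of_real_mult\<close>)
  moreover have "trace (real_diag n d) = complex_of_real (\<Sum>i<n. d i)" by (simp add: trace_def)
  ultimately show ?thesis using assms by (simp add: state_def)
qed

section \<open>Linear maps are determined by their values on states\<close>

definition mat_linear :: "nat \<Rightarrow> (complex mat \<Rightarrow> complex mat) \<Rightarrow> bool" where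
  "mat_linear d F \<longleftrightarrow> (\<forall>X \<in> carrier_mat d d. F X \<in> carrier_mat d d) \<and>
    (\<forall>X \<in> carrier_mat d d. \<forall>Y \<in> carrier_mat d d. F (X + Y) = F X + F Y) \<and>
    (\<forall>c. \<forall>X \<in> carrier_mat d d. F (c \<cdot>\<^sub>m X) = c \<cdot>\<^sub>m F X)"

lemma mat_linear_sum:
  assumes F: "mat_linear d F" and S: "finite S" and A: "\<And>m. m \<in> S \<Longrightarrow> A m \<in> carrier_mat d d"
    and ij: "i < d" "j < d"
  shows "F (mat d d (\<lambda>(i, j). \<Sum>m\<in>S. c m * A m $$ (i, j))) $$ (i, j) = (\<Sum>m\<in>S. c m * F (A m) $$ (i, j))"
  using S A
proof (induction S)
  case empty
  \<comment> \<open>The empty combination is written as 0 times the identity, so that homogeneity of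
    \<open>F\<close> gives its image.\<close>
  have "mat d d (\<lambda>(i, j). \<Sum>m\<in>{}. c m * A m $$ (i, j)) = 0 \<cdot>\<^sub>m (1\<^sub>m d :: complex mat)"
    by (rule eq_matI) auto
  then have zero: "F (mat d d (\<lambda>(i, j). \<Sum>m\<in>{}. c m * A m $$ (i, j))) = 0 \<cdot>\<^sub>m F (1\<^sub>m d)"
    using F by (simp only: mat_linear_def one_carrier_mat)
  have "F (1\<^sub>m d) \<in> carrier_mat d d" using F by (simp add: mat_linear_def)
  then show ?case unfolding zero using ij by simp
next
  case (insert m S)
  define R where "R = mat d d (\<lambda>(i, j). \<Sum>m\<in>S. c m * A m $$ (i, j))"
  have Am: "A m \<in> carrier_mat d d" using insert by simp
  have R: "R \<in> carrier_mat d d" by (simp add: R_def)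
  have "mat d d (\<lambda>(i, j). \<Sum>m\<in>insert m S. c m * A m $$ (i, j)) = c m \<cdot>\<^sub>m A m + R"
    unfolding R_def by (rule eq_matI) (use insert.hyps carrier_matD[OF Am] in auto)
  then have eq: "F (mat d d (\<lambda>(i, j). \<Sum>m\<in>insert m S. c m * A m $$ (i, j))) = c m \<cdot>\<^sub>m F (A m) + F R"
    using F Am R unfolding mat_linear_def by (metis smult_carrier_mat)
  have "F (A m) \<in> carrier_mat d d" "F R \<in> carrier_mat d d"
    using F Am R by (auto simp: mat_linear_def)
  moreover have "F R $$ (i, j) = (\<Sum>m\<in>S. c m * F (A m) $$ (i, j))"
    unfolding R_def by (rule insert.IH) (use insert.prems in simp)
  ultimately show ?case unfolding eq using insert.hyps ij by simp
qed

text \<open>The catalytic condition constrains a map on states only, whereas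
  \<open>id_tensor\<close> applies it to arbitrary blocks. The states span all matrices: an outer
  product of a vector with itself is a multiple of a state, polarization produces the matrix units,
  and these span.\<close>

lemma linear_maps_agree:
  assumes F: "mat_linear d F" and G: "mat_linear d G"
    and states: "\<And>\<rho>. state d \<rho> \<Longrightarrow> F \<rho> = G \<rho>" and X: "X \<in> carrier_mat d d"
  shows "F X = G X"
proof -
  define outer where "outer v = mat d d (\<lambda>(i, j). v i * cnj (v j))" for v :: "nat \<Rightarrow> complex"
  define E where "E x y = mat d d (\<lambda>(i, j). if i = x \<and> j = y then 1 else 0 :: complex)" for x y
  have closed: "F X \<in> carrier_mat d d" "G X \<in> carrier_mat d d" if "X \<in> carrier_mat d d" for X
    using F G that by (auto simp: mat_linear_def)
  have outer: "F (outer v) = G (outer v)" for v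
  proof -
    define N where "N = (\<Sum>i<d. (cmod (v i))\<^sup>2)"
    have N0: "N \<ge> 0" unfolding N_def by (intro sum_nonneg) auto
    obtain \<rho> where \<rho>: "\<rho> \<in> carrier_mat d d" "F (complex_of_real N \<cdot>\<^sub>m \<rho>) = G (complex_of_real N \<cdot>\<^sub>m \<rho>)"
      and eq: "outer v = complex_of_real N \<cdot>\<^sub>m \<rho>"
    proof (cases "N = 0")
      case True
      then have "v i = 0" if "i < d" for i using that by (simp add: N_def sum_nonneg_eq_0_iff)
      \<comment> \<open>The zero vector cannot be normalized; 0 times the identity takes the place
        of a multiple of a state.\<close>
      then have "outer v = complex_of_real N \<cdot>\<^sub>m 1\<^sub>m d"
        by (intro eq_matI) (auto simp: outer_def True)
      moreover have "F (0 \<cdot>\<^sub>m 1\<^sub>m d) = G (0 \<cdot>\<^sub>m 1\<^sub>m d)"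
      proof -
        have "F (0 \<cdot>\<^sub>m 1\<^sub>m d) = 0 \<cdot>\<^sub>m F (1\<^sub>m d)" "G (0 \<cdot>\<^sub>m 1\<^sub>m d) = 0 \<cdot>\<^sub>m G (1\<^sub>m d)"
          using F G by (auto simp: mat_linear_def)
        then show ?thesis using closed[of "1\<^sub>m d"] by (auto intro!: eq_matI)
      qed
      ultimately show ?thesis using that[of "1\<^sub>m d"] True by simp
    next
      case False
      define \<rho> where "\<rho> = outer (\<lambda>i. v i / complex_of_real (sqrt N))"
      have sq: "complex_of_real (sqrt N) * complex_of_real (sqrt N) = complex_of_real N"
        using N0 by (simp flip: of_real_mult)
      have \<rho>c: "\<rho> \<in> carrier_mat d d" by (simp add: \<rho>_def outer_def)
      have "psd d \<rho>"
        by (rule psd_ensemble[where M = "{()}" and w = "\<lambda>_ i. v i / complex_of_real (sqrt N)"])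
          (auto simp: \<rho>_def outer_def)
      moreover have "trace \<rho> = 1"
      proof -
        have "trace \<rho> = (\<Sum>i<d. v i * cnj (v i)) / complex_of_real N"
          by (simp add: trace_def \<rho>_def outer_def sq sum_divide_distrib)
        also have "(\<Sum>i<d. v i * cnj (v i)) = complex_of_real N"
          unfolding N_def of_real_sum complex_norm_square ..
        finally show ?thesis using False by simp
      qed
      ultimately have "F \<rho> = G \<rho>" using states by (simp add: state_def)
      moreover have "outer v = complex_of_real N \<cdot>\<^sub>m \<rho>"
        using False by (intro eq_matI) (auto simp: outer_def \<rho>_def sq)
      ultimately show ?thesis using that[of \<rho>] \<rho>c F G by (simp add: mat_linear_def)
    qed
    then show ?thesis by simp
  qed
  have unit: "F (E x y) $$ (i, j) = G (E x y) $$ (i, j)" if ij: "i < d" "j < d" for x y i j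
  proof -
    let ?S = "{1, \<i>, -1, -\<i>} :: complex set"
    define v where "v z i = (if i = x then 1 else 0) + z * (if i = y then 1 else 0 :: complex)"
      for z and i :: nat
    have distinct: "1 \<noteq> (- 1 :: complex)" "\<i> \<noteq> - \<i>" "1 \<noteq> - \<i>" "-1 \<noteq> \<i>" "\<i> \<noteq> - 1" "\<i> \<noteq> 1" "- \<i> \<noteq> 1" "1 \<noteq> \<i>"
      by (auto simp: complex_eq_iff)
    \<comment> \<open>Polarization over the fourth roots of unity: the average of \<open>z\<close>
      and of the square of \<open>z\<close> is 0, and that of \<open>z\<close> times its conjugate
      is 1, so only the term at \<open>(x, y)\<close> survives. The inequations in
      \<open>distinct\<close> keep the four summands apart.\<close>
    have "E x y = mat d d (\<lambda>(i, j). \<Sum>z\<in>?S. z / 4 * outer (v z) $$ (i, j))"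
      by (rule eq_matI) (use distinct in \<open>auto simp: E_def outer_def v_def algebra_simps\<close>)
    then have "H (E x y) $$ (i, j) = (\<Sum>z\<in>?S. z / 4 * H (outer (v z)) $$ (i, j))"
      if "mat_linear d H" for H
      using mat_linear_sum[OF that, of ?S "\<lambda>z. outer (v z)" i j "\<lambda>z. z / 4"] ij
      by (simp add: outer_def)
    then show ?thesis using F G outer by simp
  qed
  let ?S = "{..<d} \<times> {..<d}"
  have "X = mat d d (\<lambda>(i, j). \<Sum>m\<in>?S. X $$ m * E (fst m) (snd m) $$ (i, j))"
  proof (rule eq_matI)
    fix i j assume "i < dim_row (mat d d (\<lambda>(i, j). \<Sum>m\<in>?S. X $$ m * E (fst m) (snd m) $$ (i, j)))"
      "j < dim_col (mat d d (\<lambda>(i, j). \<Sum>m\<in>?S. X $$ m * E (fst m) (snd m) $$ (i, j)))"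
    then have ij: "i < d" "j < d" by auto
    have "(\<Sum>m\<in>?S. X $$ m * E (fst m) (snd m) $$ (i, j)) = (\<Sum>m\<in>?S. if m = (i, j) then X $$ m else 0)"
      using ij by (intro sum.cong refl) (auto simp: E_def)
    then show "X $$ (i, j) = mat d d (\<lambda>(i, j). \<Sum>m\<in>?S. X $$ m * E (fst m) (snd m) $$ (i, j)) $$ (i, j)"
      using ij by simp
  qed (use X in auto)
  then have "H X $$ (i, j) = (\<Sum>m\<in>?S. X $$ m * H (E (fst m) (snd m)) $$ (i, j))"
    if "mat_linear d H" "i < d" "j < d" for H i j
    using mat_linear_sum[OF that(1), of ?S "\<lambda>m. E (fst m) (snd m)" i j "\<lambda>m. X $$ m"] that
    by (simp add: E_def)
  then show ?thesis using F G unit closed[OF X] by (intro eq_matI) auto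
qed

text \<open>The action on \<open>A\<close> of a dilation whose catalyst is diagonal with eigenvalues
  \<open>s\<close>. The formula applies to all matrices, as needed for the blocks in
  \<open>id_tensor\<close>.\<close>

definition dilation_channel :: "nat \<Rightarrow> nat \<Rightarrow> (nat \<Rightarrow> real) \<Rightarrow> complex mat \<Rightarrow> complex mat \<Rightarrow> complex mat" where
  "dilation_channel d n s U X = ptrace2 d n (U * tensor X (real_diag n s) * mat_adjoint U)"

lemma dilation_channel_carrier [simp]: "dilation_channel d n s U X \<in> carrier_mat d d"
  by (simp add: dilation_channel_def)

lemma dilation_channel_entry:
  assumes "U \<in> carrier_mat (d * n) (d * n)" "X \<in> carrier_mat d d" "a < d" "a' < d"
  shows "dilation_channel d n s U X $$ (a, a')
    = (\<Sum>p<n. \<Sum>b<n. \<Sum>x<d. \<Sum>y<d. complex_of_real (s b) * U $$ (a * n + p, x * n + b) * X $$ (x, y) *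
        cnj (U $$ (a' * n + p, y * n + b)))"
  using assms by (simp add: dilation_channel_def ptrace2_def dilation_entry)

lemma mat_linear_dilation_channel:
  assumes U: "U \<in> carrier_mat (d * n) (d * n)"
  shows "mat_linear d (dilation_channel d n s U)"
  unfolding mat_linear_def
proof (intro conjI ballI allI dilation_channel_carrier)
  fix X Y :: "complex mat" assume XY: "X \<in> carrier_mat d d" "Y \<in> carrier_mat d d"
  show "dilation_channel d n s U (X + Y) = dilation_channel d n s U X + dilation_channel d n s U Y"
  proof (rule eq_matI)
    fix i j assume "i < dim_row (dilation_channel d n s U X + dilation_channel d n s U Y)"
      "j < dim_col (dilation_channel d n s U X + dilation_channel d n s U Y)"
    then have ij: "i < d" "j < d" by (auto simp: dilation_channel_def)
    then show "dilation_channel d n s U (X + Y) $$ (i, j)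
      = (dilation_channel d n s U X + dilation_channel d n s U Y) $$ (i, j)"
      using XY U carrier_matD[OF dilation_channel_carrier]
      by (simp add: dilation_channel_entry distrib_left distrib_right sum.distrib)
  qed (auto simp: dilation_channel_def)
next
  fix c and X :: "complex mat" assume X: "X \<in> carrier_mat d d"
  show "dilation_channel d n s U (c \<cdot>\<^sub>m X) = c \<cdot>\<^sub>m dilation_channel d n s U X"
  proof (rule eq_matI)
    fix i j assume "i < dim_row (c \<cdot>\<^sub>m dilation_channel d n s U X)"
      "j < dim_col (c \<cdot>\<^sub>m dilation_channel d n s U X)"
    then have ij: "i < d" "j < d" by (auto simp: dilation_channel_def)
    then show "dilation_channel d n s U (c \<cdot>\<^sub>m X) $$ (i, j) = (c \<cdot>\<^sub>m dilation_channel d n s U X) $$ (i, j)"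
      using X U carrier_matD[OF dilation_channel_carrier]
      by (simp add: dilation_channel_entry sum_distrib_left mult_ac)
  qed (auto simp: dilation_channel_def)
qed

lemma trace_dilation_channel:
  assumes U: "unitary (d * n) U" and s: "(\<Sum>b<n. s b) = 1" and X: "X \<in> carrier_mat d d"
  shows "trace (dilation_channel d n s U X) = trace X"
proof -
  have Uc: "U \<in> carrier_mat (d * n) (d * n)" using U by (rule unitary_carrier)
  have "trace (dilation_channel d n s U X) = (\<Sum>k<d * n. \<Sum>b<n. \<Sum>x<d. \<Sum>y<d. complex_of_real (s b) *
      X $$ (x, y) * (cnj (U $$ (k, y * n + b)) * U $$ (k, x * n + b)))"
    using carrier_matD[OF dilation_channel_carrier]
    by (simp add: trace_def dilation_channel_entry[OF Uc X] sum_pair_index mult_ac)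
  also have "\<dots> = (\<Sum>b<n. \<Sum>x<d. \<Sum>y<d. complex_of_real (s b) *
      X $$ (x, y) * (\<Sum>k<d * n. cnj (U $$ (k, y * n + b)) * U $$ (k, x * n + b)))"
    unfolding sum_distrib_left
    by (rule trans[OF sum.swap], rule sum.cong[OF refl], rule trans[OF sum.swap], rule sum.cong[OF refl],
        rule sum.swap)
  also have "\<dots> = (\<Sum>b<n. \<Sum>x<d. \<Sum>y<d. if y = x then complex_of_real (s b) * X $$ (x, x) else 0)"
    by (intro sum.cong refl) (auto simp: unitary_cols[OF U] pair_index_less)
  also have "\<dots> = complex_of_real (\<Sum>b<n. s b) * (\<Sum>x<d. X $$ (x, x))"
    by (simp add: sum_product)
  also have "\<dots> = trace X" using X by (simp add: s trace_def)
  finally show ?thesis .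
qed

text \<open>The vectors \<open>w\<^sub>p\<^sub>b\<^sub>m\<close> of the proof idea on the reference
  and \<open>A\<close>: column \<open>m\<close> of \<open>E\<close> is the input eigenvector,
  \<open>b\<close> and \<open>p\<close> are the catalyst basis states before and after
  \<open>U\<close>. The Kraus operator acts on the part \<open>i mod d\<close> of the index, while
  \<open>i div d\<close> belongs to the reference.\<close>

definition ensemble_vec ::
    "nat \<Rightarrow> nat \<Rightarrow> (nat \<Rightarrow> real) \<Rightarrow> complex mat \<Rightarrow> (nat \<Rightarrow> real) \<Rightarrow> complex mat \<Rightarrow> nat \<times> nat \<times> nat \<Rightarrow> nat \<Rightarrow> complex" where
  "ensemble_vec d n s U e E = (\<lambda>(p, b, m) i. complex_of_real (sqrt (s b * e m)) *
     (\<Sum>x<d. U $$ ((i mod d) * n + p, x * n + b) * E $$ ((i div d) * d + x, m)))"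

text \<open>Insert the spectral decomposition of the input into the Kraus form of the channel.
  Nonnegativity of \<open>s\<close> and \<open>e\<close> allows the weight \<open>s b * e m\<close>
  to be split into two square roots.\<close>

lemma id_tensor_dilation_channel_ensemble:
  assumes U: "U \<in> carrier_mat (d * n) (d * n)" and E: "E \<in> carrier_mat (k * d) (k * d)"
    and s: "\<And>b. b < n \<Longrightarrow> 0 \<le> s b" and e: "\<And>m. m < k * d \<Longrightarrow> 0 \<le> e m"
    and ij: "i < k * d" "j < k * d"
  shows "id_tensor k d (dilation_channel d n s U) (E * real_diag (k * d) e * mat_adjoint E) $$ (i, j)
    = (\<Sum>m\<in>{..<n} \<times> {..<n} \<times> {..<k * d}. ensemble_vec d n s U e E m i * cnj (ensemble_vec d n s U e E m j))"
proof -
  let ?X = "E * real_diag (k * d) e * mat_adjoint E"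
  let ?u = "\<lambda>i p x b. U $$ ((i mod d) * n + p, x * n + b)" and ?E = "\<lambda>i x m. E $$ ((i div d) * d + x, m)"
  obtain i1 i2 j1 j2 where i: "i1 < k" "i2 < d" "i = i1 * d + i2" and j: "j1 < k" "j2 < d" "j = j1 * d + j2"
    using ij by (elim pair_index_split)
  have dm: "i div d = i1" "i mod d = i2" "j div d = j1" "j mod d = j2" using i j by auto
  have X: "?X $$ (i1 * d + x, j1 * d + y) = (\<Sum>m<k * d. complex_of_real (e m) * ?E i x m * cnj (?E j y m))"
    if "x < d" "y < d" for x y
    using conj_real_diag_entry[OF E pair_index_less[OF i(1) that(1)] pair_index_less[OF j(1) that(2)], of e]
    by (simp add: dm)
  have "id_tensor k d (dilation_channel d n s U) ?X $$ (i, j)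
    = (\<Sum>p<n. \<Sum>b<n. \<Sum>x<d. \<Sum>y<d. complex_of_real (s b) * ?u i p x b *
        ?X $$ (i1 * d + x, j1 * d + y) * cnj (?u j p y b))"
    using ij i j by (simp add: id_tensor_def dm dilation_channel_entry[OF U])
  also have "\<dots> = (\<Sum>p<n. \<Sum>b<n. \<Sum>x<d. \<Sum>y<d. \<Sum>m<k * d. complex_of_real (s b * e m) *
        ((?u i p x b * ?E i x m) * cnj (?u j p y b * ?E j y m)))"
  proof (intro sum.cong refl)
    fix p b x y assume "x \<in> {..<d}" "y \<in> {..<d}"
    then have xy: "x < d" "y < d" by auto
    show "complex_of_real (s b) * ?u i p x b * ?X $$ (i1 * d + x, j1 * d + y) * cnj (?u j p y b)
      = (\<Sum>m<k * d. complex_of_real (s b * e m) * ((?u i p x b * ?E i x m) * cnj (?u j p y b * ?E j y m)))"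
      unfolding X[OF xy] by (simp add: sum_distrib_left sum_distrib_right mult_ac)
  qed
  also have "\<dots> = (\<Sum>p<n. \<Sum>b<n. \<Sum>m<k * d. \<Sum>x<d. \<Sum>y<d. complex_of_real (s b * e m) *
        ((?u i p x b * ?E i x m) * cnj (?u j p y b * ?E j y m)))"
  proof (rule sum.cong[OF refl], rule sum.cong[OF refl])
    fix p b
    have "(\<Sum>x<d. \<Sum>y<d. \<Sum>m<k * d. complex_of_real (s b * e m) *
        ((?u i p x b * ?E i x m) * cnj (?u j p y b * ?E j y m)))
      = (\<Sum>x<d. \<Sum>m<k * d. \<Sum>y<d. complex_of_real (s b * e m) *
        ((?u i p x b * ?E i x m) * cnj (?u j p y b * ?E j y m)))"
      by (rule sum.cong[OF refl]) (rule sum.swap)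
    also have "\<dots> = (\<Sum>m<k * d. \<Sum>x<d. \<Sum>y<d. complex_of_real (s b * e m) *
        ((?u i p x b * ?E i x m) * cnj (?u j p y b * ?E j y m)))"
      by (rule sum.swap)
    finally show "(\<Sum>x<d. \<Sum>y<d. \<Sum>m<k * d. complex_of_real (s b * e m) *
        ((?u i p x b * ?E i x m) * cnj (?u j p y b * ?E j y m)))
      = (\<Sum>m<k * d. \<Sum>x<d. \<Sum>y<d. complex_of_real (s b * e m) *
        ((?u i p x b * ?E i x m) * cnj (?u j p y b * ?E j y m)))" .
  qed
  also have "\<dots> = (\<Sum>p<n. \<Sum>b<n. \<Sum>m<k * d. ensemble_vec d n s U e E (p, b, m) i *
      cnj (ensemble_vec d n s U e E (p, b, m) j))"
  proof (intro sum.cong refl)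
    fix p b m assume "b \<in> {..<n}" "m \<in> {..<k * d}"
    then have "0 \<le> s b * e m" using s e by simp
    then have sq: "complex_of_real (s b * e m) = complex_of_real (sqrt (s b * e m)) * cnj (complex_of_real (sqrt (s b * e m)))"
      by (simp flip: of_real_mult del: real_sqrt_mult)
    show "(\<Sum>x<d. \<Sum>y<d. complex_of_real (s b * e m) * ((?u i p x b * ?E i x m) * cnj (?u j p y b * ?E j y m)))
      = ensemble_vec d n s U e E (p, b, m) i * cnj (ensemble_vec d n s U e E (p, b, m) j)"
    proof -
      have factor: "(\<Sum>x<d. \<Sum>y<d. r * cnj r * (f x * cnj (g y))) = (r * sum f {..<d}) * cnj (r * sum g {..<d})"
        for r and f g :: "nat \<Rightarrow> complex"
      proof -
        have "(r * sum f {..<d}) * cnj (r * sum g {..<d})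
          = (r * cnj r) * (sum f {..<d} * (\<Sum>y<d. cnj (g y)))" by (simp add: mult_ac)
        then show ?thesis unfolding sum_product unfolding sum_distrib_left by simp
      qed
      show ?thesis unfolding sq ensemble_vec_def prod.case by (rule factor)
    qed
  qed
  also have "\<dots> = (\<Sum>m\<in>{..<n} \<times> {..<n} \<times> {..<k * d}. ensemble_vec d n s U e E m i * cnj (ensemble_vec d n s U e E m j))"
    by (simp add: sum.cartesian_product)
  finally show ?thesis .
qed

text \<open>Complete positivity is read off from the ensemble form of the output.\<close>

lemma quantum_map_dilation_channel:
  assumes U: "unitary (d * n) U" and s: "\<And>b. b < n \<Longrightarrow> 0 \<le> s b" "(\<Sum>b<n. s b) = 1"
  shows "quantum_map d (dilation_channel d n s U)"
proof -
  have Uc: "U \<in> carrier_mat (d * n) (d * n)" using U by (rule unitary_carrier)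
  have "psd (k * d) (id_tensor k d (dilation_channel d n s U) X)" if psd: "psd (k * d) X" for k X
  proof -
    obtain E e where E: "unitary (k * d) E" and X: "X = E * real_diag (k * d) e * mat_adjoint E"
      and e: "\<And>m. m < k * d \<Longrightarrow> 0 \<le> e m"
      using psd_diagonalization[OF psd] by blast
    show ?thesis
      unfolding X
      by (rule psd_ensemble[OF _ id_tensor_dilation_channel_ensemble[OF Uc unitary_carrier[OF E] s(1) e]])
        (auto simp: id_tensor_def)
  qed
  then show ?thesis
    using mat_linear_dilation_channel[OF Uc, of s] trace_dilation_channel[OF U s(2)]
    unfolding mat_linear_def quantum_map_def by blast
qed

section \<open>Upper bound\<close>

text \<open>The squared moduli \<open>g\<close> of the entries of \<open>U\<close> satisfy three
  identities: rows sum to 1 (\<open>R\<close>), columns sum to 1 (\<open>C\<close>), and averaging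
  \<open>s\<close> with \<open>g\<close> reproduces \<open>s\<close> (\<open>H\<close>). Together
  they make the \<open>g\<close>-average of \<open>(s p - s b)\<^sup>2\<close> vanish, and each of
  its terms is nonnegative.\<close>

lemma dilation_preserves_blocks:
  assumes U: "unitary (d * n) U"
    and cat: "\<And>\<rho>. state d \<rho> \<Longrightarrow> ptrace1 d n (U * tensor \<rho> (real_diag n s) * mat_adjoint U) = real_diag n s"
    and i: "a < d" "p < n" "x < d" "b < n" and ne: "s p \<noteq> s b"
  shows "U $$ (a * n + p, x * n + b) = 0"
proof -
  have Uc: "U \<in> carrier_mat (d * n) (d * n)" using U by (rule unitary_carrier)
  define g where "g a p x b = (cmod (U $$ (a * n + p, x * n + b)))\<^sup>2" for a p x b
  have d: "d > 0" using i by auto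
  define \<rho> where "\<rho> = real_diag d (\<lambda>_. 1 / real d)"
  have \<rho>: "state d \<rho>" unfolding \<rho>_def by (rule state_real_diag) (use d in auto)
  \<comment> \<open>The diagonal entry \<open>p\<close> of the catalytic condition for the maximally
    mixed state; the factor \<open>real d\<close> clears its normalization.\<close>
  have H: "(\<Sum>a<d. \<Sum>x<d. \<Sum>b<n. g a p x b * s b) = real d * s p" if p: "p < n" for p
  proof -
    have "complex_of_real (s p) = (\<Sum>a<d. \<Sum>b<n. \<Sum>x<d. \<Sum>y<d. complex_of_real (s b) *
        U $$ (a * n + p, x * n + b) * \<rho> $$ (x, y) * cnj (U $$ (a * n + p, y * n + b)))"
      using arg_cong[OF cat[OF \<rho>], of "\<lambda>X. X $$ (p, p)"] p
      by (simp add: ptrace1_def dilation_entry[OF Uc] \<rho>_def)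
    also have "\<dots> = (\<Sum>a<d. \<Sum>b<n. \<Sum>x<d. complex_of_real (g a p x b * s b / real d))"
    proof (intro sum.cong refl)
      fix a b x assume "x \<in> {..<d}"
      then have "(\<Sum>y<d. complex_of_real (s b) * U $$ (a * n + p, x * n + b) * \<rho> $$ (x, y) *
          cnj (U $$ (a * n + p, y * n + b)))
        = (\<Sum>y<d. if y = x then complex_of_real (s b) * U $$ (a * n + p, x * n + b) *
          complex_of_real (1 / real d) * cnj (U $$ (a * n + p, x * n + b)) else 0)"
        by (intro sum.cong refl) (auto simp: \<rho>_def)
      then show "(\<Sum>y<d. complex_of_real (s b) * U $$ (a * n + p, x * n + b) * \<rho> $$ (x, y) *
          cnj (U $$ (a * n + p, y * n + b))) = complex_of_real (g a p x b * s b / real d)"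
        using \<open>x \<in> {..<d}\<close> by (simp add: g_def flip: complex_norm_square)
    qed
    also have "\<dots> = complex_of_real (\<Sum>a<d. \<Sum>b<n. \<Sum>x<d. g a p x b * s b / real d)" by simp
    finally have "s p = (\<Sum>a<d. \<Sum>b<n. \<Sum>x<d. g a p x b * s b / real d)"
      by (simp only: of_real_eq_iff)
    also have "\<dots> = (\<Sum>a<d. \<Sum>x<d. \<Sum>b<n. g a p x b * s b / real d)"
      by (intro sum.cong refl sum.swap)
    finally have "real d * s p = real d * (\<Sum>a<d. \<Sum>x<d. \<Sum>b<n. g a p x b * s b / real d)" by simp
    then show ?thesis using d by (simp add: sum_distrib_left)
  qed
  have R: "(\<Sum>x<d. \<Sum>b<n. g a p x b) = 1" if "a < d" "p < n" for a p
  proof -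
    have "complex_of_real (\<Sum>x<d. \<Sum>b<n. g a p x b) = 1"
      using unitary_rows[OF U pair_index_less[OF that] pair_index_less[OF that]]
      unfolding sum_pair_index g_def of_real_sum complex_norm_square by simp
    then show ?thesis by (metis of_real_eq_1_iff)
  qed
  have C: "(\<Sum>a<d. \<Sum>p<n. g a p x b) = 1" if "x < d" "b < n" for x b
  proof -
    have "complex_of_real (\<Sum>a<d. \<Sum>p<n. g a p x b) = 1"
      using unitary_cols[OF U pair_index_less[OF that] pair_index_less[OF that]]
      unfolding sum_pair_index g_def of_real_sum complex_norm_square by (simp add: mult.commute)
    then show ?thesis by (metis of_real_eq_1_iff)
  qed
  let ?S = "\<lambda>f. \<Sum>a<d. \<Sum>p<n. \<Sum>x<d. \<Sum>b<n. g a p x b * f p b :: real"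
  have S1: "?S (\<lambda>p b. (s p)\<^sup>2) = real d * (\<Sum>p<n. (s p)\<^sup>2)"
    by (simp add: R flip: sum_distrib_right)
  have S2: "?S (\<lambda>p b. (s b)\<^sup>2) = real d * (\<Sum>p<n. (s p)\<^sup>2)"
  proof -
    have "?S (\<lambda>p b. (s b)\<^sup>2) = (\<Sum>a<d. \<Sum>x<d. \<Sum>p<n. \<Sum>b<n. g a p x b * (s b)\<^sup>2)"
      by (intro sum.cong refl sum.swap)
    also have "\<dots> = (\<Sum>x<d. \<Sum>a<d. \<Sum>p<n. \<Sum>b<n. g a p x b * (s b)\<^sup>2)"
      by (rule sum.swap)
    also have "\<dots> = (\<Sum>x<d. \<Sum>a<d. \<Sum>b<n. \<Sum>p<n. g a p x b * (s b)\<^sup>2)"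
      by (intro sum.cong refl sum.swap)
    also have "\<dots> = (\<Sum>x<d. \<Sum>b<n. \<Sum>a<d. \<Sum>p<n. g a p x b * (s b)\<^sup>2)"
      by (intro sum.cong refl sum.swap)
    also have "\<dots> = (\<Sum>x<d. \<Sum>b<n. (s b)\<^sup>2)"
      by (intro sum.cong refl) (simp add: C flip: sum_distrib_right)
    finally show ?thesis by simp
  qed
  have S3: "?S (\<lambda>p b. s p * s b) = real d * (\<Sum>p<n. (s p)\<^sup>2)"
  proof -
    have "?S (\<lambda>p b. s p * s b) = (\<Sum>p<n. \<Sum>a<d. \<Sum>x<d. \<Sum>b<n. g a p x b * (s p * s b))"
      by (rule sum.swap)
    also have "\<dots> = (\<Sum>p<n. s p * (\<Sum>a<d. \<Sum>x<d. \<Sum>b<n. g a p x b * s b))"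
      by (simp add: sum_distrib_left mult_ac)
    also have "\<dots> = (\<Sum>p<n. real d * (s p)\<^sup>2)"
      by (intro sum.cong refl) (simp only: lessThan_iff H, simp add: power2_eq_square)
    finally show ?thesis by (simp add: sum_distrib_left)
  qed
  \<comment> \<open>Expand the square; the three sums are equal by \<open>R\<close>,
    \<open>C\<close> and \<open>H\<close> respectively, so they cancel.\<close>
  have "?S (\<lambda>p b. (s p - s b)\<^sup>2) = ?S (\<lambda>p b. (s p)\<^sup>2) + ?S (\<lambda>p b. (s b)\<^sup>2) - 2 * ?S (\<lambda>p b. s p * s b)"
    by (simp add: power2_diff sum.distrib sum_subtractf sum_distrib_left algebra_simps)
  then have zero: "?S (\<lambda>p b. (s p - s b)\<^sup>2) = 0" unfolding S1 S2 S3 by simp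
  have "g a p x b * (s p - s b)\<^sup>2 \<le> (\<Sum>b<n. g a p x b * (s p - s b)\<^sup>2)"
    by (rule member_le_sum) (use i in \<open>auto simp: g_def\<close>)
  also have "\<dots> \<le> (\<Sum>x<d. \<Sum>b<n. g a p x b * (s p - s b)\<^sup>2)"
    by (rule member_le_sum[of x _ "\<lambda>x. \<Sum>b<n. g a p x b * (s p - s b)\<^sup>2"])
      (use i in \<open>auto simp: g_def intro!: sum_nonneg\<close>)
  also have "\<dots> \<le> (\<Sum>p<n. \<Sum>x<d. \<Sum>b<n. g a p x b * (s p - s b)\<^sup>2)"
    by (rule member_le_sum[of p _ "\<lambda>p. \<Sum>x<d. \<Sum>b<n. g a p x b * (s p - s b)\<^sup>2"])
      (use i in \<open>auto simp: g_def intro!: sum_nonneg\<close>)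
  also have "\<dots> \<le> ?S (\<lambda>p b. (s p - s b)\<^sup>2)"
    by (rule member_le_sum[of a _ "\<lambda>a. \<Sum>p<n. \<Sum>x<d. \<Sum>b<n. g a p x b * (s p - s b)\<^sup>2"])
      (use i in \<open>auto simp: g_def intro!: sum_nonneg\<close>)
  finally have "g a p x b * (s p - s b)\<^sup>2 \<le> 0" using zero by simp
  then have "g a p x b \<le> 0" using ne by (simp add: mult_le_0_iff)
  then show ?thesis by (simp add: g_def)
qed

text \<open>For fixed \<open>b\<close> and \<open>m\<close>, the vectors over all \<open>p\<close>
  are the components of \<open>U\<close> applied to the eigenvector \<open>m\<close> tensored with
  the basis state \<open>b\<close>, up to the scalar \<open>sqrt (s b * e m)\<close>. A unitary
  preserves the norm, which is 1 before scaling.\<close>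

lemma ensemble_vec_norm_sum:
  assumes U: "unitary (d * n) U" and E: "unitary (k * d) E"
    and s: "0 \<le> s b" and e: "0 \<le> e m" and b: "b < n" and m: "m < k * d"
  shows "(\<Sum>p<n. \<Sum>i<k * d. (cmod (ensemble_vec d n s U e E (p, b, m) i))\<^sup>2) = s b * e m"
proof -
  \<comment> \<open>Block \<open>i\<close> of the eigenvector \<open>m\<close>, tensored with the
    catalyst basis state \<open>b\<close>.\<close>
  define v where "v i l = (if l mod n = b then E $$ (i * d + l div n, m) else 0)" for i l
  have col: "(\<Sum>l<d * n. U $$ (j, l) * v i l) = (\<Sum>x<d. U $$ (j, x * n + b) * E $$ (i * d + x, m))" for i j
    using b unfolding sum_pair_index by (simp add: v_def mult_delta_right)
  have norm_v: "(\<Sum>l<d * n. (cmod (v i l))\<^sup>2) = (\<Sum>x<d. (cmod (E $$ (i * d + x, m)))\<^sup>2)" for i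
  proof -
    have "(\<Sum>l<d * n. (cmod (v i l))\<^sup>2)
      = (\<Sum>x<d. \<Sum>c<n. if c = b then (cmod (E $$ (i * d + x, m)))\<^sup>2 else 0)"
      unfolding sum_pair_index by (intro sum.cong refl) (auto simp: v_def)
    then show ?thesis using b by simp
  qed
  have "complex_of_real (\<Sum>i<k * d. (cmod (E $$ (i, m)))\<^sup>2) = 1"
    using unitary_cols[OF E m m] unfolding of_real_sum complex_norm_square by (simp add: mult.commute)
  then have norm_E: "(\<Sum>i<k * d. (cmod (E $$ (i, m)))\<^sup>2) = 1" by (metis of_real_eq_1_iff)
  define h where "h i j = (cmod (\<Sum>l<d * n. U $$ (j, l) * v i l))\<^sup>2" for i j
  have "(\<Sum>p<n. \<Sum>i<k * d. (cmod (ensemble_vec d n s U e E (p, b, m) i))\<^sup>2)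
    = (\<Sum>p<n. \<Sum>i<k. \<Sum>a<d. s b * e m * h i (a * n + p))"
    unfolding sum_pair_index[of _ k d] h_def col
    by (intro sum.cong refl) (use s e in \<open>auto simp: ensemble_vec_def norm_mult power_mult_distrib\<close>)
  also have "\<dots> = (\<Sum>i<k. \<Sum>p<n. \<Sum>a<d. s b * e m * h i (a * n + p))"
    by (rule sum.swap)
  also have "\<dots> = (\<Sum>i<k. \<Sum>a<d. \<Sum>p<n. s b * e m * h i (a * n + p))"
    by (intro sum.cong refl sum.swap)
  also have "\<dots> = s b * e m * (\<Sum>i<k. \<Sum>j<d * n. h i j)"
    by (simp add: sum_pair_index[of _ d n] sum_distrib_left)
  also have "\<dots> = s b * e m * (\<Sum>i<k * d. (cmod (E $$ (i, m)))\<^sup>2)"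
    unfolding h_def unitary_parseval[OF U] norm_v sum_pair_index[of _ k d] ..
  finally show ?thesis by (simp add: norm_E)
qed

text \<open>Supplies the positive arguments of the logarithms: a positive total forces some
  \<open>t i\<close> to be nonzero, and \<open>powr\<close> of a nonzero base is positive.\<close>

lemma sum_powr_pos:
  fixes t :: "nat \<Rightarrow> real"
  assumes "(\<Sum>i<n. t i) > 0" "\<And>i. i < n \<Longrightarrow> 0 < c i"
  shows "0 < (\<Sum>i<n. t i powr \<alpha> * c i)"
proof -
  obtain i where i: "i < n" "t i \<noteq> 0"
    using assms by (metis lessThan_iff less_irrefl sum.neutral)
  have "0 < t i powr \<alpha> * c i" using i assms(2) by simp
  also have "\<dots> \<le> (\<Sum>i<n. t i powr \<alpha> * c i)"
    by (rule member_le_sum[of i _ "\<lambda>i. t i powr \<alpha> * c i"]) (use i assms(2) in \<open>auto simp: less_imp_le\<close>)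
  finally show ?thesis .
qed

lemma sum_triple_swap:
  "(\<Sum>m\<in>{..<n} \<times> {..<n} \<times> {..<K}. f m) = (\<Sum>b<n. \<Sum>m<K. \<Sum>p<(n::nat). f (p, b, m))"
  for K :: nat and f :: "_ \<Rightarrow> real"
proof -
  have "(\<Sum>m\<in>{..<n} \<times> {..<n} \<times> {..<K}. f m) = (\<Sum>p<n. \<Sum>b<n. \<Sum>m<K. f (p, b, m))"
    by (simp add: sum.cartesian_product)
  also have "\<dots> = (\<Sum>b<n. \<Sum>p<n. \<Sum>m<K. f (p, b, m))" by (rule sum.swap)
  also have "\<dots> = (\<Sum>b<n. \<Sum>m<K. \<Sum>p<n. f (p, b, m))" by (intro sum.cong refl sum.swap)
  finally show ?thesis .
qed

text \<open>The output power sum is compared first with that of the ensemble norms \<open>N\<close>,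
  then, for each \<open>b\<close> and \<open>m\<close>, with the uniform distribution over the block
  of \<open>b\<close>. The resulting bound factors into the catalytic sum \<open>B\<close> times the
  input power sum, and the logarithm makes this additive.\<close>

lemma renyi_entropy_dilation_channel_le:
  assumes \<alpha>: "0 < \<alpha>" "\<alpha> \<noteq> 1" and U: "unitary (d * n) U"
    and s: "\<And>b. b < n \<Longrightarrow> 0 \<le> s b" "(\<Sum>b<n. s b) = 1"
    and blocks: "\<And>a p x b. a < d \<Longrightarrow> p < n \<Longrightarrow> x < d \<Longrightarrow> b < n \<Longrightarrow> s p \<noteq> s b \<Longrightarrow> U $$ (a * n + p, x * n + b) = 0"
    and \<rho>: "state (k * d) \<rho>"
  shows "renyi_entropy \<alpha> (id_tensor k d (dilation_channel d n s U) \<rho>) - renyi_entropy \<alpha> \<rho>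
    \<le> 1 / (1 - \<alpha>) * log 2 (\<Sum>b<n. s b powr \<alpha> * block_size n s b powr (1 - \<alpha>))"
proof -
  let ?K = "k * d" and ?M = "{..<n} \<times> {..<n} \<times> {..<k * d}"
  have Uc: "U \<in> carrier_mat (d * n) (d * n)" using U by (rule unitary_carrier)
  obtain E e where E: "unitary ?K E" and \<rho>_eq: "\<rho> = E * real_diag ?K e * mat_adjoint E"
    and e: "\<And>m. m < ?K \<Longrightarrow> 0 \<le> e m" "(\<Sum>m<?K. e m) = 1"
    using state_diagonalization[OF \<rho>] by blast
  define \<tau> where "\<tau> = id_tensor k d (dilation_channel d n s U) \<rho>"
  have "psd ?K \<tau>"
    using quantum_map_dilation_channel[OF U s] \<rho> by (auto simp: \<tau>_def quantum_map_def state_def)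
  then obtain T t where T: "unitary ?K T" and \<tau>_eq: "\<tau> = T * real_diag ?K t * mat_adjoint T"
    using psd_diagonalization by blast
  define w where "w = ensemble_vec d n s U e E"
  have ens: "\<tau> $$ (i, j) = (\<Sum>m\<in>?M. w m i * cnj (w m j))" if "i < ?K" "j < ?K" for i j
    unfolding \<tau>_def \<rho>_eq w_def
    by (rule id_tensor_dilation_channel_ensemble[OF Uc unitary_carrier[OF E] s(1) e(1) that])
  define N where "N m = (\<Sum>i<?K. (cmod (w m i))\<^sup>2)" for m
  have N_nonneg: "0 \<le> N m" for m unfolding N_def by (intro sum_nonneg) auto
  have N_sum: "(\<Sum>p<n. N (p, b, m)) = s b * e m" if "b < n" "m < ?K" for b m
    unfolding N_def w_def using that by (intro ensemble_vec_norm_sum U E s e)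
  have N_blocks: "N (p, b, m) = 0" if "p < n" "b < n" "s p \<noteq> s b" for p b m
  proof -
    have "w (p, b, m) i = 0" if i: "i < ?K" for i
    proof -
      have "i mod d < d" using i by (cases d) auto
      then show ?thesis
        using \<open>p < n\<close> \<open>b < n\<close> \<open>s p \<noteq> s b\<close> by (simp add: w_def ensemble_vec_def blocks)
    qed
    then show ?thesis by (simp add: N_def)
  qed
  have dim_\<tau>: "dim_row \<tau> = ?K" by (simp add: \<tau>_def id_tensor_def)
  \<comment> \<open>That the output eigenvalues sum to 1 ensures that their power sum is
    positive.\<close>
  have "complex_of_real (\<Sum>x<?K. t x) = trace \<tau>"
    unfolding \<tau>_eq trace_conj_real_diag[OF T] ..
  also have "\<dots> = (\<Sum>i<?K. \<Sum>m\<in>?M. w m i * cnj (w m i))"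
    by (simp add: trace_def dim_\<tau> ens)
  also have "\<dots> = complex_of_real (\<Sum>m\<in>?M. N m)"
    unfolding N_def of_real_sum complex_norm_square by (rule sum.swap)
  finally have "(\<Sum>x<?K. t x) = (\<Sum>m\<in>?M. N m)" by (simp only: of_real_eq_iff)
  also have "\<dots> = (\<Sum>b<n. \<Sum>m<?K. s b * e m)"
    unfolding sum_triple_swap by (intro sum.cong refl) (simp add: N_sum)
  also have "\<dots> = 1" by (simp add: s e flip: sum_product)
  finally have t_sum: "(\<Sum>x<?K. t x) = 1" .
  define B where "B = (\<Sum>b<n. s b powr \<alpha> * block_size n s b powr (1 - \<alpha>))"
  \<comment> \<open>Only those \<open>p\<close> with \<open>s p = s b\<close> contribute, so the
    number of terms is the multiplicity and their total is still \<open>s b * e m\<close>.\<close>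
  have block_bound: "(1 - \<alpha>) * (\<Sum>p<n. N (p, b, m) powr \<alpha>)
      \<le> (1 - \<alpha>) * (block_size n s b powr (1 - \<alpha>) * (s b * e m) powr \<alpha>)" if bm: "b < n" "m < ?K" for b m
  proof -
    let ?S = "{c \<in> {..<n}. s c = s b}"
    have "(\<Sum>p<n. N (p, b, m) powr \<alpha>) = (\<Sum>p\<in>?S. N (p, b, m) powr \<alpha>)"
      using N_blocks bm by (intro sum.mono_neutral_right) auto
    moreover have "s b * e m = (\<Sum>p\<in>?S. N (p, b, m))"
      unfolding N_sum[OF bm, symmetric] using N_blocks bm by (intro sum.mono_neutral_right) auto
    ultimately show ?thesis
      using sum_powr_le_card[OF \<alpha>, of ?S "\<lambda>p. N (p, b, m)"] bm N_nonneg
      by (auto simp: block_size_def)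
  qed
  have "(1 - \<alpha>) * (\<Sum>x<?K. t x powr \<alpha>) \<le> (1 - \<alpha>) * (\<Sum>m\<in>?M. N m powr \<alpha>)"
    unfolding N_def
    by (rule ensemble_spectrum_powr_ineq[OF \<alpha> _ T]) (use ens in \<open>auto simp flip: \<tau>_eq\<close>)
  also have "\<dots> = (\<Sum>b<n. \<Sum>m<?K. (1 - \<alpha>) * (\<Sum>p<n. N (p, b, m) powr \<alpha>))"
    unfolding sum_triple_swap by (simp add: sum_distrib_left)
  also have "\<dots> \<le> (\<Sum>b<n. \<Sum>m<?K. (1 - \<alpha>) * (block_size n s b powr (1 - \<alpha>) * (s b * e m) powr \<alpha>))"
    by (intro sum_mono block_bound) auto
  also have "\<dots> = (1 - \<alpha>) * (B * (\<Sum>m<?K. e m powr \<alpha>))"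
    unfolding B_def sum_product unfolding sum_distrib_left
    by (intro sum.cong refl) (use s e in \<open>auto simp: powr_mult mult_ac\<close>)
  finally have key: "(1 - \<alpha>) * (\<Sum>x<?K. t x powr \<alpha>) \<le> (1 - \<alpha>) * (B * (\<Sum>m<?K. e m powr \<alpha>))" .
  have pos: "0 < (\<Sum>x<?K. t x powr \<alpha>)" "0 < (\<Sum>m<?K. e m powr \<alpha>)"
    using sum_powr_pos[of t ?K "\<lambda>_. 1" \<alpha>] sum_powr_pos[of e ?K "\<lambda>_. 1" \<alpha>] t_sum e by auto
  have Bpos: "0 < B"
    unfolding B_def by (rule sum_powr_pos) (use s block_size_pos in auto)
  \<comment> \<open>The factor \<open>1 - \<alpha>\<close> in \<open>key\<close> and the prefactor
    here have the same sign, so the reversal of the inequality for \<alpha> > 1 is undone.\<close>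
  have "1 / (1 - \<alpha>) * log 2 (\<Sum>x<?K. t x powr \<alpha>) \<le> 1 / (1 - \<alpha>) * log 2 (B * (\<Sum>m<?K. e m powr \<alpha>))"
  proof (cases "\<alpha> < 1")
    case True
    then show ?thesis using key pos Bpos by (intro mult_left_mono) auto
  next
    case False
    then have "B * (\<Sum>m<?K. e m powr \<alpha>) \<le> (\<Sum>x<?K. t x powr \<alpha>)"
      using key \<alpha> by (simp add: mult_le_cancel_left)
    then show ?thesis using False \<alpha> pos Bpos by (intro mult_left_mono_neg) (auto simp: divide_le_0_iff)
  qed
  also have "log 2 (B * (\<Sum>m<?K. e m powr \<alpha>)) = log 2 B + log 2 (\<Sum>m<?K. e m powr \<alpha>)"
    using pos Bpos by (simp add: log_mult)
  finally show ?thesis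
    unfolding \<tau>_def[symmetric] unfolding \<tau>_eq \<rho>_eq renyi_entropy_conj_real_diag[OF T] renyi_entropy_conj_real_diag[OF E]
      B_def[symmetric] by (simp add: distrib_left)
qed

text \<open>Reduction to a diagonal catalyst that is returned unchanged, followed by the bound for
  such dilations.\<close>

theorem extractable_renyi_entropy_le:
  assumes \<alpha>: "0 < \<alpha>" "\<alpha> \<noteq> 1" and \<sigma>: "state n \<sigma>"
    and x: "x \<in> extractable_renyi_entropies \<alpha> n \<sigma>"
  shows "x \<le> catalytic_renyi_entropy \<alpha> \<sigma>"
proof -
  obtain k d \<Phi> \<rho> where x_eq: "x = renyi_entropy \<alpha> (id_tensor k d \<Phi> \<rho>) - renyi_entropy \<alpha> \<rho>"
    and cat: "catalytic_map d n \<sigma> \<Phi>" and \<rho>: "state (k * d) \<rho>"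
    using x by (auto simp: extractable_renyi_entropies_def)
  obtain Q s where Q: "unitary n Q" and \<sigma>_eq: "\<sigma> = Q * real_diag n s * mat_adjoint Q"
    and s: "\<And>b. b < n \<Longrightarrow> 0 \<le> s b" "(\<Sum>b<n. s b) = 1"
    using state_diagonalization[OF \<sigma>] by blast
  obtain U V where U: "unitary (d * n) U" and V: "unitary n V"
    and \<Phi>: "\<And>\<rho>. state d \<rho> \<Longrightarrow> ptrace2 d n (U * tensor \<rho> \<sigma> * mat_adjoint U) = \<Phi> \<rho>"
    and B: "\<And>\<rho>. state d \<rho> \<Longrightarrow> ptrace1 d n (U * tensor \<rho> \<sigma> * mat_adjoint U) = V * \<sigma> * mat_adjoint V"
    using cat unfolding catalytic_map_def by blast
  \<comment> \<open>Undo the catalyst rotation \<open>V\<close> and pass to the eigenbasis of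
    \<sigma>; together with \<open>Q\<close> on the input side, this leaves the map on
    \<open>A\<close> unaltered.\<close>
  define W where "W = mat_adjoint Q * mat_adjoint V"
  define U' where "U' = tensor (1\<^sub>m d) W * U * tensor (1\<^sub>m d) Q"
  have W: "unitary n W" unfolding W_def by (intro unitary_mult unitary_adjoint Q V)
  have U': "unitary (d * n) U'"
    unfolding U'_def by (intro unitary_mult unitary_tensor unitary_one U W Q)
  have c: "Q \<in> carrier_mat n n" "V \<in> carrier_mat n n" "W \<in> carrier_mat n n" "\<sigma> \<in> carrier_mat n n"
    "U \<in> carrier_mat (d * n) (d * n)" "real_diag n s \<in> carrier_mat n n"
    using Q V W U \<sigma> by (auto simp: unitary_carrier state_def psd_def)
  have \<Phi>': "dilation_channel d n s U' \<rho> = \<Phi> \<rho>"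
    and B': "ptrace1 d n (U' * tensor \<rho> (real_diag n s) * mat_adjoint U') = real_diag n s"
    if \<rho>: "state d \<rho>" for \<rho>
  proof -
    have \<rho>c: "\<rho> \<in> carrier_mat d d" using \<rho> by (simp add: state_def psd_def)
    let ?Y = "U * tensor \<rho> \<sigma> * mat_adjoint U"
    have Y: "?Y \<in> carrier_mat (d * n) (d * n)" using c \<rho>c by simp
    have eq: "U' * tensor \<rho> (real_diag n s) * mat_adjoint U'
      = tensor (1\<^sub>m d) W * ?Y * mat_adjoint (tensor (1\<^sub>m d) W)"
      unfolding U'_def \<sigma>_eq by (rule local_conj_dilation) (use c \<rho>c in auto)
    show "dilation_channel d n s U' \<rho> = \<Phi> \<rho>"
      unfolding dilation_channel_def eq ptrace2_local_conj[OF W Y] by (rule \<Phi>[OF \<rho>])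
    have "W * (V * \<sigma> * mat_adjoint V) * mat_adjoint W
      = mat_adjoint (V * Q) * (V * Q * real_diag n s * mat_adjoint (V * Q)) * (V * Q)"
      unfolding W_def \<sigma>_eq using c
      by (simp add: mat_adjoint_mult[of _ n n _ n] assoc_mult_mat[of _ n n _ n _ n])
    also have "\<dots> = real_diag n s"
      using conj_unitary_cancel[OF unitary_adjoint[OF unitary_mult[OF V Q]] c(6)] by simp
    finally show "ptrace1 d n (U' * tensor \<rho> (real_diag n s) * mat_adjoint U') = real_diag n s"
      unfolding eq ptrace1_local_conj[OF c(3) Y] B[OF \<rho>] .
  qed
  have "quantum_map d \<Phi>" using cat by (simp add: catalytic_map_def)
  then have "mat_linear d \<Phi>" by (auto simp: quantum_map_def mat_linear_def)
  then have "\<Phi> X = dilation_channel d n s U' X" if "X \<in> carrier_mat d d" for X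
    using linear_maps_agree[OF _ mat_linear_dilation_channel[OF unitary_carrier[OF U']] \<Phi>'[symmetric] that]
    by blast
  then have "id_tensor k d \<Phi> \<rho> = id_tensor k d (dilation_channel d n s U') \<rho>"
    by (simp add: id_tensor_def)
  then have "x = renyi_entropy \<alpha> (id_tensor k d (dilation_channel d n s U') \<rho>) - renyi_entropy \<alpha> \<rho>"
    by (simp add: x_eq)
  also have "\<dots> \<le> 1 / (1 - \<alpha>) * log 2 (\<Sum>b<n. s b powr \<alpha> * block_size n s b powr (1 - \<alpha>))"
    by (rule renyi_entropy_dilation_channel_le[OF \<alpha> U' s dilation_preserves_blocks[OF U' B'] \<rho>])
  finally show ?thesis unfolding \<sigma>_eq catalytic_renyi_entropy_conj_real_diag[OF Q] .
qed

section \<open>Attainment\<close>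

text \<open>Orthogonality of characters: the terms are powers of an \<open>r\<close>-th root of
  unity \<open>z\<close>, which is different from 1 when \<open>j\<close> and \<open>k\<close>
  differ, so the geometric sum vanishes.\<close>

lemma sum_cis_roots_of_unity:
  assumes "j < r" "k < r"
  shows "(\<Sum>m<r. cis (2 * pi * real j * real m / real r) * cnj (cis (2 * pi * real k * real m / real r)))
    = (if j = k then of_nat r else 0)"
proof -
  define z where "z = cis (2 * pi * real j / real r) * cnj (cis (2 * pi * real k / real r))"
  have pow: "cis (2 * pi * real j * real m / real r) * cnj (cis (2 * pi * real k * real m / real r)) = z ^ m" for m
    unfolding z_def power_mult_distrib complex_cnj_power[symmetric] DeMoivre by (simp add: mult_ac)
  show ?thesis
  proof (cases "j = k")
    case True
    have "z = 1" by (simp add: z_def True cis_cnj cis_mult)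
    then show ?thesis unfolding pow using True by simp
  next
    case False
    have "inj_on (\<lambda>k. cis (2 * pi * real k / real r)) {..<r}"
      using bij_betw_roots_unity[of r] assms by (simp add: bij_betw_def)
    then have "cis (2 * pi * real j / real r) \<noteq> cis (2 * pi * real k / real r)"
      using False assms by (auto dest: inj_onD)
    moreover have "cis (2 * pi * real j / real r) = z * cis (2 * pi * real k / real r)"
      by (simp add: z_def cis_cnj cis_mult)
    ultimately have z: "z \<noteq> 1" by auto
    have root: "cis (2 * pi * real i / real r) ^ r = 1" for i
      using assms cis_multiple_2pi[of "real i"] by (simp add: DeMoivre)
    have "z ^ r = 1" unfolding z_def power_mult_distrib complex_cnj_power[symmetric] root by simp
    then show ?thesis using z False by (simp add: pow sum_gp_strict)
  qed
qed

text \<open>\<open>G\<close> maps each eigenspace to itself, and its columns form a basis unbiased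
  to the standard one there. For unitary \<open>G\<close> these are the mutually unbiased bases of
  the proof idea.\<close>

definition block_unbiased :: "nat \<Rightarrow> (nat \<Rightarrow> real) \<Rightarrow> complex mat \<Rightarrow> bool" where
  "block_unbiased n s G \<longleftrightarrow> (\<forall>p<n. \<forall>b<n.
     (cmod (G $$ (p, b)))\<^sup>2 = (if s p = s b then 1 / real (block_size n s b) else 0))"

text \<open>Take the normalized discrete Fourier matrix on each eigenspace, with its basis
  enumerated by \<open>pos\<close>.\<close>

lemma exists_block_unbiased: "\<exists>G. unitary n G \<and> block_unbiased n s G"
proof -
  have "\<exists>h. bij_betw h {c \<in> {..<n}. s c = l} {0..<card {c \<in> {..<n}. s c = l}}" for l
    by (rule ex_bij_betw_finite_nat) simp
  then obtain h where h: "\<And>l. bij_betw (h l) {c \<in> {..<n}. s c = l} {0..<card {c \<in> {..<n}. s c = l}}"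
    by metis
  \<comment> \<open>The enumeration is chosen per eigenvalue, so all positions of one block share
    it.\<close>
  define pos where "pos b = h (s b) b" for b
  let ?r = "block_size n s" and ?B = "\<lambda>p. {c \<in> {..<n}. s c = s p}"
  have r_eq: "?r b = ?r p" if "s b = s p" for b p using that by (simp add: block_size_def)
  have pos_bij: "bij_betw pos (?B p) {..<?r p}" for p
    using h[of "s p"] unfolding pos_def block_size_def lessThan_atLeast0
    by (rule bij_betw_cong[THEN iffD1, rotated]) auto
  have pos_less: "pos b < ?r p" if "b < n" "s b = s p" for b p
    using bij_betwE[OF pos_bij[of p]] that by auto
  define G where "G = mat n n (\<lambda>(p, b). if s p = s b
    then cis (2 * pi * real (pos p) * real (pos b) / real (?r b)) / complex_of_real (sqrt (real (?r b))) else 0)"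
  have Gc: "G \<in> carrier_mat n n" by (simp add: G_def)
  have "G * mat_adjoint G = 1\<^sub>m n"
  proof (rule eq_matI)
    fix p q assume "p < dim_row (1\<^sub>m n :: complex mat)" "q < dim_col (1\<^sub>m n :: complex mat)"
    then have pq: "p < n" "q < n" by auto
    have entry: "(G * mat_adjoint G) $$ (p, q) = (\<Sum>b<n. G $$ (p, b) * cnj (G $$ (q, b)))"
      using Gc pq by (subst mult_entry[of _ n n _ n]) (auto simp: mat_adjoint_entry)
    show "(G * mat_adjoint G) $$ (p, q) = 1\<^sub>m n $$ (p, q)"
    proof (cases "s p = s q")
      case False
      then have "(\<Sum>b<n. G $$ (p, b) * cnj (G $$ (q, b))) = 0"
        using pq by (intro sum.neutral) (auto simp: G_def)
      then show ?thesis using entry False pq by auto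
    next
      case True
      let ?f = "\<lambda>m. cis (2 * pi * real (pos p) * real m / real (?r p)) *
        cnj (cis (2 * pi * real (pos q) * real m / real (?r p)))"
      have rpos: "?r p > 0" using pq by (intro block_size_pos)
      have sq: "complex_of_real (sqrt (real (?r p))) * complex_of_real (sqrt (real (?r p))) = of_nat (?r p)"
        by (simp flip: of_real_mult)
      have "(\<Sum>b<n. G $$ (p, b) * cnj (G $$ (q, b))) = (\<Sum>b\<in>?B p. G $$ (p, b) * cnj (G $$ (q, b)))"
        using pq by (intro sum.mono_neutral_right) (auto simp: G_def)
      also have "\<dots> = (\<Sum>b\<in>?B p. ?f (pos b) / of_nat (?r p))"
      proof (rule sum.cong[OF refl])
        fix b assume "b \<in> ?B p"
        then have b: "b < n" "s b = s p" by auto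
        show "G $$ (p, b) * cnj (G $$ (q, b)) = ?f (pos b) / of_nat (?r p)"
          using pq True b by (simp add: G_def r_eq[OF b(2)] flip: sq)
      qed
      also have "\<dots> = (\<Sum>m<?r p. ?f m / of_nat (?r p))"
        by (rule sum.reindex_bij_betw[OF pos_bij])
      also have "\<dots> = (\<Sum>m<?r p. ?f m) / of_nat (?r p)" by (simp add: sum_divide_distrib)
      also have "\<dots> = (if pos p = pos q then 1 else 0)"
        using rpos pos_less[of p p] pos_less[of q p] pq True by (subst sum_cis_roots_of_unity) auto
      also have "pos p = pos q \<longleftrightarrow> p = q"
        using bij_betw_imp_inj_on[OF pos_bij[of p]] pq True by (auto dest: inj_onD)
      finally show ?thesis using entry pq by simp
    qed
  qed (use Gc in auto)
  then have "unitary n G" by (intro unitaryI' Gc)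
  moreover have "block_unbiased n s G"
    using block_size_pos[of _ n s]
    by (auto simp: block_unbiased_def G_def norm_divide power_divide)
  ultimately show ?thesis by blast
qed

text \<open>
  System \<open>A\<close> is a pair of \<open>n\<close>-dimensional registers.  In the eigenbasis of the catalyst, the unitary
  first applies the transposition of \<open>0\<close> and \<open>b\<close> to the first register controlled on the catalyst
  state \<open>b\<close>, then \<open>G\<close> to the catalyst, then the transposition of \<open>0\<close> and \<open>p\<close> to the second register
  controlled on the new catalyst state \<open>p\<close>.
\<close>

definition extraction_unitary :: "nat \<Rightarrow> complex mat \<Rightarrow> complex mat" where
  "extraction_unitary n G = mat (n * n * n) (n * n * n) (\<lambda>(i, j).
     let a = i div n; p = i mod n; x = j div n; b = j mod n in
     if a div n = transpose 0 b (x div n) \<and> a mod n = transpose 0 p (x mod n) then G $$ (p, b) else 0)"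

lemma extraction_unitary_carrier: "extraction_unitary n G \<in> carrier_mat (n * n * n) (n * n * n)"
  by (simp add: extraction_unitary_def)

text \<open>Transpositions are involutions, so the condition is solved for the input registers: for
  each output index and each \<open>b\<close>, a single pair of register values remains in the
  sums.\<close>

lemma extraction_unitary_entry:
  assumes "a1 < n" "a2 < n" "p < n" "x1 < n" "x2 < n" "b < n"
  shows "extraction_unitary n G $$ ((a1 * n + a2) * n + p, (x1 * n + x2) * n + b)
    = (if x1 = transpose 0 b a1 \<and> x2 = transpose 0 p a2 then G $$ (p, b) else 0)"
proof -
  have "a1 = transpose 0 b x1 \<longleftrightarrow> x1 = transpose 0 b a1" "a2 = transpose 0 p x2 \<longleftrightarrow> x2 = transpose 0 p a2"
    by (metis transpose_involutory)+
  then show ?thesis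
    using assms by (simp add: extraction_unitary_def pair_index_less Let_def)
qed

lemma transpose_zero_less: "b < n \<Longrightarrow> a < n \<Longrightarrow> transpose 0 b a < (n :: nat)"
  by (auto simp: transpose_def)

lemma sum_delta_pair:
  fixes f :: "nat \<Rightarrow> nat \<Rightarrow> complex"
  assumes "c1 < n" "c2 < m"
  shows "(\<Sum>x1<n. \<Sum>x2<m. (if x1 = c1 \<and> x2 = c2 then g else 0) * f x1 x2) = g * f c1 c2"
proof -
  have "(\<Sum>x1<n. \<Sum>x2<m. (if x1 = c1 \<and> x2 = c2 then g else 0) * f x1 x2)
    = (\<Sum>x1<n. if x1 = c1 then (\<Sum>x2<m. if x2 = c2 then g * f c1 c2 else 0) else 0)"
  proof (rule sum.cong[OF refl])
    fix x1
    show "(\<Sum>x2<m. (if x1 = c1 \<and> x2 = c2 then g else 0) * f x1 x2)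
      = (if x1 = c1 then (\<Sum>x2<m. if x2 = c2 then g * f c1 c2 else 0) else 0)"
      using assms(2) by (cases "x1 = c1") (auto simp: mult_delta_left)
  qed
  then show ?thesis using assms by simp
qed

text \<open>Rows are orthonormal: the transposition by the common \<open>b\<close> is injective and
  forces \<open>a1 = c1\<close>; the sum over \<open>b\<close> then is an inner product of rows of
  \<open>G\<close> and forces \<open>p = q\<close>, after which the second registers agree
  too.\<close>

lemma unitary_extraction_unitary:
  assumes G: "unitary n G"
  shows "unitary (n * n * n) (extraction_unitary n G)"
proof (rule unitaryI'[OF extraction_unitary_carrier])
  let ?U = "extraction_unitary n G"
  note Uc = extraction_unitary_carrier[of n G]
  show "?U * mat_adjoint ?U = 1\<^sub>m (n * n * n)"
  proof (rule eq_mat_pair_index[of _ "n * n" n])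
    fix a p c q assume "a < n * n" and p: "p < n" and "c < n * n" and q: "q < n"
    then obtain a1 a2 c1 c2 where a: "a1 < n" "a2 < n" "a = a1 * n + a2"
      and c: "c1 < n" "c2 < n" "c = c1 * n + c2" by (elim pair_index_split)
    have "(?U * mat_adjoint ?U) $$ (a * n + p, c * n + q)
      = (\<Sum>x<n * n. \<Sum>b<n. ?U $$ (a * n + p, x * n + b) * cnj (?U $$ (c * n + q, x * n + b)))"
      using Uc \<open>a < n * n\<close> \<open>c < n * n\<close> p q
      by (subst mult_pair_entry[of _ "n * n" n]) (auto simp: adjoint_pair_entry[of _ "n * n" n])
    also have "\<dots> = (\<Sum>b<n. \<Sum>x<n * n. ?U $$ (a * n + p, x * n + b) * cnj (?U $$ (c * n + q, x * n + b)))"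
      by (rule sum.swap)
    also have "\<dots> = (\<Sum>b<n. G $$ (p, b) *
        cnj (if transpose 0 b a1 = transpose 0 b c1 \<and> transpose 0 p a2 = transpose 0 q c2 then G $$ (q, b) else 0))"
      unfolding sum_pair_index a(3) c(3)
      by (intro sum.cong refl)
        (simp add: extraction_unitary_entry a c p q sum_delta_pair transpose_zero_less)
    also have "\<dots> = (if a1 = c1 \<and> transpose 0 p a2 = transpose 0 q c2
        then \<Sum>b<n. G $$ (p, b) * cnj (G $$ (q, b)) else 0)"
      by (auto simp: inj_eq[OF inj_transpose])
    also have "\<dots> = (if a1 = c1 \<and> a2 = c2 \<and> p = q then 1 else 0)"
      using unitary_rows[OF G p q] by (auto simp: inj_eq[OF inj_transpose])
    also have "\<dots> = 1\<^sub>m (n * n * n) $$ (a * n + p, c * n + q)"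
    proof -
      have "a * n + p = c * n + q \<longleftrightarrow> a1 = c1 \<and> a2 = c2 \<and> p = q"
        unfolding a(3) c(3)
        by (metis a(2) c(2) p q div_mult_self3 div_less mod_mult_self3 mod_less add_0_right less_nat_zero_code)
      then show ?thesis using pair_index_less[OF \<open>a < n * n\<close> p] pair_index_less[OF \<open>c < n * n\<close> q] by simp
    qed
    finally show "(?U * mat_adjoint ?U) $$ (a * n + p, c * n + q) = 1\<^sub>m (n * n * n) $$ (a * n + p, c * n + q)" .
  qed (use Uc in auto)
qed

lemma cnj_delta: "cnj (if P then g else 0) = (if P then cnj g else 0)"
  by simp

lemma extraction_dilation_entry:
  assumes X: "X \<in> carrier_mat (n * n) (n * n)"
    and i: "a1 < n" "a2 < n" "p < n" "c1 < n" "c2 < n" "q < n"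
  shows "(extraction_unitary n G * tensor X (real_diag n s) * mat_adjoint (extraction_unitary n G))
      $$ ((a1 * n + a2) * n + p, (c1 * n + c2) * n + q)
    = (\<Sum>b<n. complex_of_real (s b) * G $$ (p, b) * cnj (G $$ (q, b)) *
        X $$ (transpose 0 b a1 * n + transpose 0 p a2, transpose 0 b c1 * n + transpose 0 q c2))"
proof -
  let ?U = "extraction_unitary n G"
  have "(?U * tensor X (real_diag n s) * mat_adjoint ?U) $$ ((a1 * n + a2) * n + p, (c1 * n + c2) * n + q)
    = (\<Sum>b<n. \<Sum>x<n * n. \<Sum>y<n * n. complex_of_real (s b) * ?U $$ ((a1 * n + a2) * n + p, x * n + b) *
      X $$ (x, y) * cnj (?U $$ ((c1 * n + c2) * n + q, y * n + b)))"
    by (rule dilation_entry[OF extraction_unitary_carrier X])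
      (use i in \<open>auto simp: pair_index_less\<close>)
  also have "\<dots> = (\<Sum>b<n. complex_of_real (s b) * (\<Sum>x<n * n. ?U $$ ((a1 * n + a2) * n + p, x * n + b) *
      (\<Sum>y<n * n. cnj (?U $$ ((c1 * n + c2) * n + q, y * n + b)) * X $$ (x, y))))"
    by (simp add: sum_distrib_left mult_ac)
  also have "\<dots> = (\<Sum>b<n. complex_of_real (s b) * (G $$ (p, b) * (cnj (G $$ (q, b)) *
      X $$ (transpose 0 b a1 * n + transpose 0 p a2, transpose 0 b c1 * n + transpose 0 q c2))))"
    unfolding sum_pair_index
    by (intro sum.cong refl)
      (simp add: extraction_unitary_entry i sum_delta_pair transpose_zero_less cnj_delta)
  finally show ?thesis by (simp add: mult_ac)
qed

lemma sum_transpose_zero: 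
  fixes f :: "nat \<Rightarrow> 'a :: comm_monoid_add"
  assumes "b < n"
  shows "(\<Sum>a<n. f (transpose 0 b a)) = (\<Sum>a<n. f a)"
proof -
  have "bij_betw (transpose 0 b) {..<n} {..<n}"
    by (rule bij_betwI[of _ _ _ "transpose 0 b"]) (use assms in \<open>auto simp: transpose_zero_less\<close>)
  then show ?thesis by (rule sum.reindex_bij_betw)
qed

text \<open>Summing over the first register absorbs the transposition by \<open>b\<close>, so the
  state enters only through \<open>Y\<close>, which does not depend on \<open>b\<close>. What
  remains is the conjugate of the catalyst by \<open>G\<close>, which is the catalyst itself; on the
  diagonal \<open>Y\<close> is the trace of \<open>X\<close>.\<close>

lemma ptrace1_extraction:
  assumes G: "unitary n G" and unb: "block_unbiased n s G" and X: "state (n * n) X"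
  shows "ptrace1 (n * n) n (extraction_unitary n G * tensor X (real_diag n s) *
    mat_adjoint (extraction_unitary n G)) = real_diag n s"
proof (rule eq_matI)
  fix p q assume "p < dim_row (real_diag n s)" "q < dim_col (real_diag n s)"
  then have pq: "p < n" "q < n" by auto
  have Xc: "X \<in> carrier_mat (n * n) (n * n)" and tr: "trace X = 1" using X by (auto simp: state_def psd_def)
  \<comment> \<open>\<open>G\<close> vanishes between different eigenvalues, so it commutes with the
    diagonal catalyst.\<close>
  have sG: "complex_of_real (s b) * G $$ (p, b) = complex_of_real (s p) * G $$ (p, b)" if b: "b < n" for b
  proof (cases "s p = s b")
    case False
    then have "(cmod (G $$ (p, b)))\<^sup>2 = 0"
      using unb b pq by (simp only: block_unbiased_def if_False)
    then show ?thesis by simp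
  qed simp
  define Y where "Y = (\<Sum>a2<n. \<Sum>a1<n. X $$ (a1 * n + transpose 0 p a2, a1 * n + transpose 0 q a2))"
  have "ptrace1 (n * n) n (extraction_unitary n G * tensor X (real_diag n s) *
      mat_adjoint (extraction_unitary n G)) $$ (p, q)
    = (\<Sum>a1<n. \<Sum>a2<n. \<Sum>b<n. complex_of_real (s b) * G $$ (p, b) * cnj (G $$ (q, b)) *
        X $$ (transpose 0 b a1 * n + transpose 0 p a2, transpose 0 b a1 * n + transpose 0 q a2))"
    using pq by (simp add: ptrace1_def sum_pair_index[of _ n n] extraction_dilation_entry[OF Xc])
  also have "\<dots> = (\<Sum>a2<n. \<Sum>a1<n. \<Sum>b<n. complex_of_real (s b) * G $$ (p, b) * cnj (G $$ (q, b)) *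
        X $$ (transpose 0 b a1 * n + transpose 0 p a2, transpose 0 b a1 * n + transpose 0 q a2))"
    by (rule sum.swap)
  also have "\<dots> = (\<Sum>a2<n. \<Sum>b<n. \<Sum>a1<n. complex_of_real (s b) * G $$ (p, b) * cnj (G $$ (q, b)) *
        X $$ (transpose 0 b a1 * n + transpose 0 p a2, transpose 0 b a1 * n + transpose 0 q a2))"
    by (intro sum.cong refl sum.swap)
  also have "\<dots> = (\<Sum>b<n. \<Sum>a2<n. \<Sum>a1<n. complex_of_real (s b) * G $$ (p, b) * cnj (G $$ (q, b)) *
        X $$ (transpose 0 b a1 * n + transpose 0 p a2, transpose 0 b a1 * n + transpose 0 q a2))"
    by (rule sum.swap)
  also have "\<dots> = (\<Sum>b<n. complex_of_real (s b) * G $$ (p, b) * cnj (G $$ (q, b)) * Y)"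
  proof (intro sum.cong refl)
    fix b assume "b \<in> {..<n}"
    then have b: "b < n" by simp
    show "(\<Sum>a2<n. \<Sum>a1<n. complex_of_real (s b) * G $$ (p, b) * cnj (G $$ (q, b)) *
        X $$ (transpose 0 b a1 * n + transpose 0 p a2, transpose 0 b a1 * n + transpose 0 q a2))
      = complex_of_real (s b) * G $$ (p, b) * cnj (G $$ (q, b)) * Y"
      unfolding Y_def sum_distrib_left[symmetric]
        sum_transpose_zero[OF b, of "\<lambda>a1. X $$ (a1 * n + transpose 0 p _, a1 * n + transpose 0 q _)"] ..
  qed
  also have "\<dots> = complex_of_real (s p) * (\<Sum>b<n. G $$ (p, b) * cnj (G $$ (q, b))) * Y"
    by (simp add: sG sum_distrib_left sum_distrib_right mult.assoc)
  also have "\<dots> = (if p = q then complex_of_real (s p) * Y else 0)"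
    using pq by (simp add: unitary_rows[OF G])
  also have "\<dots> = (if p = q then complex_of_real (s p) else 0)"
  proof -
    have "(\<Sum>a2<n. \<Sum>a1<n. X $$ (a1 * n + transpose 0 p a2, a1 * n + transpose 0 p a2))
      = (\<Sum>a2<n. \<Sum>a1<n. X $$ (a1 * n + a2, a1 * n + a2))"
      by (rule sum_transpose_zero[OF pq(1), of "\<lambda>a2. \<Sum>a1<n. X $$ (a1 * n + a2, a1 * n + a2)"])
    also have "\<dots> = trace X"
      using Xc by (subst sum.swap) (simp add: trace_def sum_pair_index)
    finally show ?thesis using tr by (auto simp: Y_def)
  qed
  finally show "ptrace1 (n * n) n (extraction_unitary n G * tensor X (real_diag n s) *
      mat_adjoint (extraction_unitary n G)) $$ (p, q) = real_diag n s $$ (p, q)"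
    using pq by simp
qed auto

text \<open>Starting from 0 in both registers, the first one ends in \<open>b\<close> and the second
  in \<open>p\<close>, with probability \<open>s b\<close> times the squared modulus of
  \<open>G\<close> at \<open>(p, b)\<close>. Since \<open>b\<close> is diagonal in the catalyst and
  \<open>p\<close> is traced out, no coherences survive.\<close>

lemma dilation_channel_extraction:
  assumes unb: "block_unbiased n s G" and n: "n > 0"
  shows "dilation_channel (n * n) n s (extraction_unitary n G) (real_diag (n * n) (\<lambda>i. of_bool (i = 0)))
    = real_diag (n * n) (\<lambda>a. if s (a div n) = s (a mod n) then s (a div n) / real (block_size n s (a div n)) else 0)"
proof (rule eq_mat_pair_index[of _ n n])
  let ?X = "real_diag (n * n) (\<lambda>i. of_bool (i = 0))"
  fix a1 a2 c1 c2 assume i: "a1 < n" "a2 < n" "c1 < n" "c2 < n"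
  have X: "?X $$ (transpose 0 b a1 * n + transpose 0 p a2, transpose 0 b c1 * n + transpose 0 p c2)
    = of_bool (b = a1 \<and> p = a2 \<and> a1 = c1 \<and> a2 = c2)" if "b < n" "p < n" for b p
  proof -
    \<comment> \<open>The transposition of 0 and \<open>b\<close> sends \<open>a\<close> to 0
      exactly when \<open>a = b\<close>, so only the input component 0 is picked up.\<close>
    have zero: "transpose 0 b a * n + transpose 0 p c = 0 \<longleftrightarrow> b = a \<and> p = c" for a c
      using n by (auto simp: transpose_def)
    have "?X $$ (i, j) = of_bool (i = 0 \<and> j = 0)" if "i < n * n" "j < n * n" for i j
      using that by auto
    from this[of "transpose 0 b a1 * n + transpose 0 p a2" "transpose 0 b c1 * n + transpose 0 p c2"]
    show ?thesis
      unfolding zero using that i by (auto simp: pair_index_less transpose_zero_less)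
  qed
  have "dilation_channel (n * n) n s (extraction_unitary n G) ?X $$ (a1 * n + a2, c1 * n + c2)
    = (\<Sum>p<n. \<Sum>b<n. complex_of_real (s b) * G $$ (p, b) * cnj (G $$ (p, b)) *
        of_bool (b = a1 \<and> p = a2 \<and> a1 = c1 \<and> a2 = c2))"
    unfolding dilation_channel_def using i
    by (simp add: ptrace2_def pair_index_less extraction_dilation_entry X)
  also have "\<dots> = (\<Sum>p<n. \<Sum>b<n. if b = a1 then (if p = a2 then
      of_bool (a1 = c1 \<and> a2 = c2) * (complex_of_real (s a1) * G $$ (a2, a1) * cnj (G $$ (a2, a1))) else 0) else 0)"
    by (intro sum.cong refl) auto
  also have "\<dots> = of_bool (a1 = c1 \<and> a2 = c2) * (complex_of_real (s a1) * complex_of_real ((cmod (G $$ (a2, a1)))\<^sup>2))"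
    using i by (simp add: mult.assoc flip: complex_norm_square)
  also have "\<dots> = real_diag (n * n) (\<lambda>a. if s (a div n) = s (a mod n) then s (a div n) /
      real (block_size n s (a div n)) else 0) $$ (a1 * n + a2, c1 * n + c2)"
  proof -
    have "a1 * n + a2 = c1 * n + c2 \<longleftrightarrow> a1 = c1 \<and> a2 = c2"
      by (metis i div_mult_self3 div_less mod_mult_self3 mod_less add_0_right less_nat_zero_code)
    then show ?thesis using unb i by (auto simp: block_unbiased_def pair_index_less)
  qed
  finally show "dilation_channel (n * n) n s (extraction_unitary n G) ?X $$ (a1 * n + a2, c1 * n + c2)
    = real_diag (n * n) (\<lambda>a. if s (a div n) = s (a mod n) then s (a div n) /
      real (block_size n s (a div n)) else 0) $$ (a1 * n + a2, c1 * n + c2)" .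
qed auto

lemma renyi_entropy_real_diag: "renyi_entropy \<alpha> (real_diag n d) = 1 / (1 - \<alpha>) * log 2 (\<Sum>i<n. d i powr \<alpha>)"
  using renyi_entropy_conj_real_diag[OF unitary_one, of \<alpha> n d] by simp

lemma id_tensor_one:
  assumes "X \<in> carrier_mat d d" "\<Phi> X \<in> carrier_mat d d"
  shows "id_tensor 1 d \<Phi> X = \<Phi> X"
proof (rule eq_matI)
  fix i j assume "i < dim_row (\<Phi> X)" "j < dim_col (\<Phi> X)"
  then have ij: "i < d" "j < d" using assms by auto
  have "mat d d (\<lambda>(a, b). X $$ (a, b)) = X" using assms by (intro eq_matI) auto
  then show "id_tensor 1 d \<Phi> X $$ (i, j) = \<Phi> X $$ (i, j)" using ij by (simp add: id_tensor_def)
qed (use assms in \<open>auto simp: id_tensor_def\<close>)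

text \<open>The witnesses are a one-dimensional reference and the pure input with both registers 0,
  whose entropy is 0. The output contains \<open>s b\<close> divided by its multiplicity
  \<open>r\<close> once for each \<open>p\<close> in the block, so \<open>b\<close> contributes
  \<open>r\<close> times the \<alpha>-th power of that quotient.\<close>

theorem catalytic_renyi_entropy_extractable:
  assumes \<sigma>: "state n \<sigma>"
  shows "catalytic_renyi_entropy \<alpha> \<sigma> \<in> extractable_renyi_entropies \<alpha> n \<sigma>"
proof -
  obtain Q s where Q: "unitary n Q" and \<sigma>_eq: "\<sigma> = Q * real_diag n s * mat_adjoint Q"
    and s: "\<And>b. b < n \<Longrightarrow> 0 \<le> s b" "(\<Sum>b<n. s b) = 1"
    using state_diagonalization[OF \<sigma>] by blast
  have n: "n > 0" using s(2) by (cases n) auto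
  obtain G where G: "unitary n G" and unb: "block_unbiased n s G" using exists_block_unbiased by blast
  let ?d = "n * n"
  define U where "U = extraction_unitary n G"
  have U: "unitary (?d * n) U" unfolding U_def by (rule unitary_extraction_unitary[OF G])
  define \<Phi> where "\<Phi> = dilation_channel ?d n s U"
  \<comment> \<open>Rotate the catalyst into its eigenbasis, apply the extraction and rotate back.
    The catalyst then returns to \<sigma> exactly, so the identity serves as
    \<open>V\<close>.\<close>
  define U' where "U' = tensor (1\<^sub>m ?d) Q * U * tensor (1\<^sub>m ?d) (mat_adjoint Q)"
  have U': "unitary (?d * n) U'"
    unfolding U'_def by (intro unitary_mult unitary_tensor unitary_one unitary_adjoint U Q)
  have c: "Q \<in> carrier_mat n n" "mat_adjoint Q \<in> carrier_mat n n" "\<sigma> \<in> carrier_mat n n"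
    "U \<in> carrier_mat (?d * n) (?d * n)"
    using Q U \<sigma> by (auto simp: unitary_carrier state_def psd_def)
  have "catalytic_map ?d n \<sigma> \<Phi>"
    unfolding catalytic_map_def
  proof (intro conjI exI allI impI)
    show "quantum_map ?d \<Phi>" unfolding \<Phi>_def by (rule quantum_map_dilation_channel[OF U s])
    show "unitary (?d * n) U'" "unitary n (1\<^sub>m n)" using U' by (auto intro: unitary_one)
    fix \<rho> assume \<rho>: "state ?d \<rho>"
    have \<rho>c: "\<rho> \<in> carrier_mat ?d ?d" using \<rho> by (simp add: state_def psd_def)
    let ?Y = "U * tensor \<rho> (real_diag n s) * mat_adjoint U"
    have Y: "?Y \<in> carrier_mat (?d * n) (?d * n)" using c \<rho>c by simp
    have "mat_adjoint Q * \<sigma> * mat_adjoint (mat_adjoint Q) = real_diag n s"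
      unfolding \<sigma>_eq using conj_unitary_cancel[OF unitary_adjoint[OF Q] real_diag_carrier, of s] by simp
    then have eq: "U' * tensor \<rho> \<sigma> * mat_adjoint U' = tensor (1\<^sub>m ?d) Q * ?Y * mat_adjoint (tensor (1\<^sub>m ?d) Q)"
      unfolding U'_def using local_conj_dilation[OF c(1,2,3,4) \<rho>c] by simp
    show "ptrace2 ?d n (U' * tensor \<rho> \<sigma> * mat_adjoint U') = \<Phi> \<rho>"
      unfolding eq ptrace2_local_conj[OF Q Y] \<Phi>_def dilation_channel_def ..
    show "ptrace1 ?d n (U' * tensor \<rho> \<sigma> * mat_adjoint U') = 1\<^sub>m n * \<sigma> * mat_adjoint (1\<^sub>m n)"
      unfolding eq ptrace1_local_conj[OF c(1) Y] using c ptrace1_extraction[OF G unb \<rho>]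
      by (simp add: U_def \<sigma>_eq)
  qed
  moreover
  define \<rho> where "\<rho> = real_diag ?d (\<lambda>i. of_bool (i = 0))"
  have "state (1 * ?d) \<rho>"
    unfolding \<rho>_def using n by (simp only: mult_1) (intro state_real_diag, auto simp: of_bool_def)
  moreover have "renyi_entropy \<alpha> (id_tensor 1 ?d \<Phi> \<rho>) - renyi_entropy \<alpha> \<rho> = catalytic_renyi_entropy \<alpha> \<sigma>"
  proof -
    have \<rho>c: "\<rho> \<in> carrier_mat ?d ?d" by (simp add: \<rho>_def)
    have "(\<Sum>i<?d. of_bool (i = 0) powr \<alpha>) = (\<Sum>i<?d. if i = 0 then 1 else 0 :: real)"
      by (intro sum.cong refl) auto
    then have \<rho>0: "renyi_entropy \<alpha> \<rho> = 0"
      unfolding \<rho>_def renyi_entropy_real_diag using n by simp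
    have "renyi_entropy \<alpha> (id_tensor 1 ?d \<Phi> \<rho>) = 1 / (1 - \<alpha>) * log 2 (\<Sum>a<?d.
        (if s (a div n) = s (a mod n) then s (a div n) / real (block_size n s (a div n)) else 0) powr \<alpha>)"
      unfolding id_tensor_one[of \<rho> ?d \<Phi>, OF \<rho>c, unfolded \<Phi>_def, OF dilation_channel_carrier, folded \<Phi>_def]
      unfolding \<Phi>_def \<rho>_def U_def dilation_channel_extraction[OF unb n] renyi_entropy_real_diag ..
    also have "(\<Sum>a<?d. (if s (a div n) = s (a mod n) then s (a div n) / real (block_size n s (a div n)) else 0) powr \<alpha>)
      = (\<Sum>b<n. \<Sum>p<n. if s p = s b then (s b / real (block_size n s b)) powr \<alpha> else 0)"
      unfolding sum_pair_index by (intro sum.cong refl) auto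
    also have "\<dots> = (\<Sum>b<n. s b powr \<alpha> * block_size n s b powr (1 - \<alpha>))"
    proof (intro sum.cong refl)
      fix b assume "b \<in> {..<n}"
      then have b: "b < n" by simp
      have "(\<Sum>p<n. if s p = s b then (s b / real (block_size n s b)) powr \<alpha> else 0)
        = real (block_size n s b) * (s b / real (block_size n s b)) powr \<alpha>"
        by (simp add: block_size_def flip: sum.inter_filter)
      also have "\<dots> = s b powr \<alpha> * block_size n s b powr (1 - \<alpha>)"
        using s(1)[OF b] block_size_pos[OF b, of s] by (simp add: powr_divide powr_diff)
      finally show "(\<Sum>p<n. if s p = s b then (s b / real (block_size n s b)) powr \<alpha> else 0)
        = s b powr \<alpha> * block_size n s b powr (1 - \<alpha>)" .
    qed
    finally show ?thesis unfolding \<rho>0 \<sigma>_eq catalytic_renyi_entropy_conj_real_diag[OF Q] by simp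
  qed
  ultimately show ?thesis unfolding extractable_renyi_entropies_def by (intro CollectI) metis
qed

theorem theorem9:
  fixes \<alpha> :: real and dB :: nat and \<sigma> :: "complex mat"
  assumes "0 < \<alpha>" and "\<alpha> \<noteq> 1"
    and "state dB \<sigma>"
  shows "is_maximal_extractable_renyi_entropy \<alpha> dB \<sigma> (catalytic_renyi_entropy \<alpha> \<sigma>)"
  unfolding is_maximal_extractable_renyi_entropy_def
  using assms by (blast intro: catalytic_renyi_entropy_extractable extractable_renyi_entropy_le)

end
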